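(* Let $G$ be a finite simple unmixed graph such that $I_c(G)$ is linearly presented. If $C_1,C_2$ are distinct minimal vertex covers of $G$ such that the induced subgraph $G[C_1\triangle C_2]$ is unmixed and not Cohen–Macaulay, then there is a minimal vertex cover $C$ of $G$ such that $C_1\cap C_2\not\subset C\subset C_1\cup C_2$.
   Context: $G$ has vertices $t_1,\dots,t_s$, $S=K[t_1,\dots,t_s]$, $K$ a field. A graph is unmixed if all minimal vertex covers (inclusion-minimal vertex sets meeting every edge) have equal size. $I_c(G)$ is generated by $\prod_{t_i\in C}t_i$ over minimal vertex covers $C$; a monomial ideal minimally generated by $u_1,\dots,u_r$ is linearly presented if all $u_i$ have the same degree and the kernel of $S^r\to S$, $e_i\mapsto u_i$, is generated by vectors with linear-form entries. $\triangle$ is symmetric difference, $G[L]$ the subgraph induced on $L$. A graph $H$ is Cohen–Macaulay if $R/I(H)$ is Cohen–Macaulay, with $R$ the polynomial ring on $V(H)$ and $I(H)$ generated by $tt'$ for edges $\{t,t'\}$ of $H$. *)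

theory Defs
  imports "HOL-Library.Poly_Mapping"
begin

(* Multivariate polynomials over the field 'k in variables indexed by 'v:
   monomials are finitely supported exponent maps 'v \<Rightarrow>\<^sub>0 nat. *)
type_synonym ('v, 'k) mpoly = "('v \<Rightarrow>\<^sub>0 nat) \<Rightarrow>\<^sub>0 'k"

definition polys_on :: "'v set \<Rightarrow> ('v, 'k::zero) mpoly set" where
  "polys_on V = {p :: ('v, 'k) mpoly. \<forall>m \<in> Poly_Mapping.keys p. Poly_Mapping.keys m \<subseteq> V}"

definition var :: "'v \<Rightarrow> ('v, 'k::{zero,one}) mpoly" where
  "var t = Poly_Mapping.single (Poly_Mapping.single t (1::nat)) 1"

definition mdeg :: "('v \<Rightarrow>\<^sub>0 nat) \<Rightarrow> nat" where
  "mdeg m = (\<Sum>v\<in>Poly_Mapping.keys m. Poly_Mapping.lookup m v)"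

(* homogeneous of degree d (the zero polynomial is homogeneous of every degree) *)
definition homog :: "nat \<Rightarrow> ('v, 'k::zero) mpoly \<Rightarrow> bool" where
  "homog d p \<longleftrightarrow> (\<forall>m \<in> Poly_Mapping.keys p. mdeg m = d)"

definition gen_ideal :: "'v set \<Rightarrow> ('v, 'k::comm_ring_1) mpoly set \<Rightarrow> ('v, 'k) mpoly set" where
  "gen_ideal V B = {p. \<exists>F c. finite F \<and> F \<subseteq> B \<and> (\<forall>b\<in>F. c b \<in> polys_on V)
                          \<and> p = (\<Sum>b\<in>F. c b * b)}"

definition is_ideal :: "'v set \<Rightarrow> ('v, 'k::comm_ring_1) mpoly set \<Rightarrow> bool" where
  "is_ideal V I \<longleftrightarrow> I \<subseteq> polys_on V \<and> 0 \<in> I \<and> (\<forall>a\<in>I. \<forall>b\<in>I. a + b \<in> I)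
                    \<and> (\<forall>a\<in>I. \<forall>r\<in>polys_on V. r * a \<in> I)"

definition prime_ideal :: "'v set \<Rightarrow> ('v, 'k::comm_ring_1) mpoly set \<Rightarrow> bool" where
  "prime_ideal V P \<longleftrightarrow> is_ideal V P \<and> P \<noteq> polys_on V
      \<and> (\<forall>a\<in>polys_on V. \<forall>b\<in>polys_on V. a * b \<in> P \<longrightarrow> a \<in> P \<or> b \<in> P)"

definition krull_dim :: "'v set \<Rightarrow> ('v, 'k::comm_ring_1) mpoly set \<Rightarrow> nat" where
  "krull_dim V I = Sup {n. \<exists>P :: nat \<Rightarrow> ('v, 'k) mpoly set.
       (\<forall>i\<le>n. prime_ideal V (P i) \<and> I \<subseteq> P i) \<and> (\<forall>i<n. P i \<subset> P (Suc i))}"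

definition irrelevant_ideal :: "'v set \<Rightarrow> ('v, 'k::comm_ring_1) mpoly set" where
  "irrelevant_ideal V = gen_ideal V (var ` V)"

definition regular_seq :: "'v set \<Rightarrow> ('v, 'k::comm_ring_1) mpoly set \<Rightarrow> ('v, 'k) mpoly list \<Rightarrow> bool" where
  "regular_seq V I fs \<longleftrightarrow> set fs \<subseteq> irrelevant_ideal V
     \<and> gen_ideal V (I \<union> set fs) \<noteq> polys_on V
     \<and> (\<forall>i < length fs. \<forall>g \<in> polys_on V.
          fs ! i * g \<in> gen_ideal V (I \<union> set (take i fs)) \<longrightarrow> g \<in> gen_ideal V (I \<union> set (take i fs)))"

definition depth :: "'v set \<Rightarrow> ('v, 'k::comm_ring_1) mpoly set \<Rightarrow> nat" where
  "depth V I = Sup {length fs | fs. regular_seq V I fs}"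

(* K[V]/I is Cohen-Macaulay (graded setting: depth w.r.t. the maximal homogeneous ideal = dim) *)
definition cohen_macaulay :: "'v set \<Rightarrow> ('v, 'k::comm_ring_1) mpoly set \<Rightarrow> bool" where
  "cohen_macaulay V I \<longleftrightarrow> depth V I = krull_dim V I"

definition simple_graph :: "'v set \<Rightarrow> 'v set set \<Rightarrow> bool" where
  "simple_graph V E \<longleftrightarrow> finite V \<and> (\<forall>e\<in>E. e \<subseteq> V \<and> card e = 2)"

definition vertex_cover :: "'v set \<Rightarrow> 'v set set \<Rightarrow> 'v set \<Rightarrow> bool" where
  "vertex_cover V E C \<longleftrightarrow> C \<subseteq> V \<and> (\<forall>e\<in>E. e \<inter> C \<noteq> {})"

definition min_vertex_cover :: "'v set \<Rightarrow> 'v set set \<Rightarrow> 'v set \<Rightarrow> bool" where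
  "min_vertex_cover V E C \<longleftrightarrow> vertex_cover V E C \<and> (\<forall>D. D \<subset> C \<longrightarrow> \<not> vertex_cover V E D)"

definition unmixed :: "'v set \<Rightarrow> 'v set set \<Rightarrow> bool" where
  "unmixed V E \<longleftrightarrow> (\<forall>C D. min_vertex_cover V E C \<and> min_vertex_cover V E D \<longrightarrow> card C = card D)"

(* edges of the induced subgraph G[L]; its vertex set is L *)
definition induced_edges :: "'v set set \<Rightarrow> 'v set \<Rightarrow> 'v set set" where
  "induced_edges E L = {e \<in> E. e \<subseteq> L}"

definition edge_ideal :: "'v set \<Rightarrow> 'v set set \<Rightarrow> ('v, 'k::comm_ring_1) mpoly set" where
  "edge_ideal V E = gen_ideal V {var a * var b | a b. {a, b} \<in> E}"

definition cm_graph :: "'k::comm_ring_1 itself \<Rightarrow> 'v set \<Rightarrow> 'v set set \<Rightarrow> bool" where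
  "cm_graph _ V E \<longleftrightarrow> cohen_macaulay V (edge_ideal V E :: ('v, 'k) mpoly set)"

(* minimal generators of the cover ideal I_c(G): prod_{t in C} t, C minimal vertex cover *)
definition cover_gens :: "'v set \<Rightarrow> 'v set set \<Rightarrow> ('v, 'k::comm_ring_1) mpoly set" where
  "cover_gens V E = (\<lambda>C. \<Prod>t\<in>C. var t) ` {C. min_vertex_cover V E C}"

definition syz :: "'v set \<Rightarrow> ('v, 'k::comm_ring_1) mpoly set \<Rightarrow> (('v, 'k) mpoly \<Rightarrow> ('v, 'k) mpoly) set" where
  "syz V U = {f. (\<forall>u. f u \<in> polys_on V) \<and> (\<forall>u. u \<notin> U \<longrightarrow> f u = 0) \<and> (\<Sum>u\<in>U. f u * u) = 0}"

(* the ideal minimally generated by the finite set U is linearly presented *)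
definition linearly_presented :: "'v set \<Rightarrow> ('v, 'k::comm_ring_1) mpoly set \<Rightarrow> bool" where
  "linearly_presented V U \<longleftrightarrow> finite U \<and> (\<exists>d. \<forall>u\<in>U. homog d u)
     \<and> (\<exists>Lin \<subseteq> syz V U. (\<forall>g\<in>Lin. \<forall>u\<in>U. homog 1 (g u))
          \<and> (\<forall>f\<in>syz V U. \<exists>F c. finite F \<and> F \<subseteq> Lin \<and> (\<forall>g\<in>F. c g \<in> polys_on V)
                \<and> f = (\<lambda>u. \<Sum>g\<in>F. c g * g u)))"

end

theory Submission
  imports Defs "HOL-Library.FuncSet" "HOL.Vector_Spaces"
begin

text \<open>Suppose every minimal cover inside \<open>C1 \<union> C2\<close> contains \<open>C1 \<inter> C2\<close>. Linear presentation joins C1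
  to C2 by minimal covers inside \<open>C1 \<union> C2\<close>, each obtained from the previous one by exchanging a single
  vertex. Restricted to \<open>L = (C1 - C2) \<union> (C2 - C1)\<close> these are minimum covers of the bipartite graph
  \<open>G[L]\<close>, and tracking the exchanges yields a perfect matching \<open>\<beta>\<close> for which the relation
  ``\<open>{a, \<beta> b}\<close> is an edge'' is antisymmetric; unmixedness makes it transitive. For the graph of such a
  poset the elements \<open>a - \<beta> a\<close> form a regular sequence. Regular sequences give chains of primes of the
  same length, and a chain has length at most the number of variables outside its bottom prime, so
  \<open>G[L]\<close> is Cohen--Macaulay.\<close>

subsection \<open>Polynomials, ideals and primes\<close>

text \<open>The contradiction hypothesis enters through cardinality only: a minimal cover inside
  \<open>C1 \<union> C2\<close> has size \<open>card C1\<close> and contains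
  \<open>C1 \<inter> C2\<close>, so its trace on \<open>L\<close> has exactly
  \<open>card (C1 - C2)\<close> elements, the least size of a cover of \<open>G[L]\<close>. The
  obstacle is that the path may release a vertex and take it back, so the exchanges alone define no
  matching. The sets of all vertices that have left or entered so far only grow, by one matched pair
  at a time, and a vertex that has already left is never adjacent to one that enters later for the
  first time. This order of entry is the source of antisymmetry. On the algebraic side, depth and
  dimension share their bounds: a regular sequence reaches \<open>card A\<close>, and the matching
  edges leave at most \<open>card A\<close> variables outside a prime. The bound on prime chains
  replaces transcendence degree by a growth comparison between products of chain elements and
  monomials.\<close>

abbreviation expo :: "'v \<Rightarrow> 'v \<Rightarrow>\<^sub>0 nat" where
  "expo v \<equiv> Poly_Mapping.single v (1::nat)"

lemma polys_onD: "p \<in> polys_on V \<Longrightarrow> m \<in> Poly_Mapping.keys p \<Longrightarrow> Poly_Mapping.keys m \<subseteq> V"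
  by (simp add: polys_on_def)

lemma polys_on_0 [simp]: "0 \<in> polys_on V"
  by (simp add: polys_on_def)

lemma polys_on_const [simp]: "Poly_Mapping.single 0 c \<in> polys_on V"
  by (simp add: polys_on_def)

lemma polys_on_1 [simp]: "(1 :: ('v, 'k::zero_neq_one) mpoly) \<in> polys_on V"
  by (simp add: polys_on_def)

lemma polys_on_add:
  fixes p q :: "('v, 'k::comm_ring_1) mpoly"
  shows "p \<in> polys_on V \<Longrightarrow> q \<in> polys_on V \<Longrightarrow> p + q \<in> polys_on V"
  unfolding polys_on_def using keys_add[of p q] by blast

lemma polys_on_uminus:
  fixes p :: "('v, 'k::comm_ring_1) mpoly"
  shows "p \<in> polys_on V \<Longrightarrow> - p \<in> polys_on V"
  by (auto simp: polys_on_def in_keys_iff)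

lemma polys_on_diff:
  fixes p q :: "('v, 'k::comm_ring_1) mpoly"
  shows "p \<in> polys_on V \<Longrightarrow> q \<in> polys_on V \<Longrightarrow> p - q \<in> polys_on V"
  using polys_on_add[of p V "- q"] polys_on_uminus[of q V] by simp

lemma keys_mult_expo:
  assumes "m \<in> Poly_Mapping.keys (p * q :: ('v, 'k::comm_ring_1) mpoly)"
  obtains a b where "a \<in> Poly_Mapping.keys p" "b \<in> Poly_Mapping.keys q" "m = a + b"
  using keys_mult[of p q] assms by blast

lemma polys_on_mult:
  fixes p q :: "('v, 'k::comm_ring_1) mpoly"
  assumes "p \<in> polys_on V" "q \<in> polys_on V"
  shows "p * q \<in> polys_on V"
  unfolding polys_on_def
proof (intro CollectI ballI)
  fix m assume "m \<in> Poly_Mapping.keys (p * q)"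
  then obtain a b where "a \<in> Poly_Mapping.keys p" "b \<in> Poly_Mapping.keys q" "m = a + b"
    by (rule keys_mult_expo)
  then show "Poly_Mapping.keys m \<subseteq> V"
    using polys_onD[OF assms(1)] polys_onD[OF assms(2)] keys_add[of a b] by blast
qed

lemma polys_on_sum:
  fixes f :: "'i \<Rightarrow> ('v, 'k::comm_ring_1) mpoly"
  shows "(\<And>i. i \<in> F \<Longrightarrow> f i \<in> polys_on V) \<Longrightarrow> sum f F \<in> polys_on V"
  by (induction F rule: infinite_finite_induct) (auto intro: polys_on_add)

lemma polys_on_prod:
  fixes f :: "'i \<Rightarrow> ('v, 'k::comm_ring_1) mpoly"
  shows "(\<And>i. i \<in> F \<Longrightarrow> f i \<in> polys_on V) \<Longrightarrow> prod f F \<in> polys_on V"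
  by (induction F rule: infinite_finite_induct) (auto intro: polys_on_mult)

lemma polys_on_power:
  fixes p :: "('v, 'k::comm_ring_1) mpoly"
  shows "p \<in> polys_on V \<Longrightarrow> p ^ n \<in> polys_on V"
  by (induction n) (auto intro: polys_on_mult)

lemma var_polys_on: "v \<in> V \<Longrightarrow> (var v :: ('v, 'k::comm_ring_1) mpoly) \<in> polys_on V"
  by (simp add: polys_on_def var_def)

lemma single_polys_on: "Poly_Mapping.keys m \<subseteq> V \<Longrightarrow> Poly_Mapping.single m c \<in> polys_on V"
  by (simp add: polys_on_def)

section \<open>Ideals in the variables of \<open>V\<close>\<close>

lemma is_idealD:
  assumes "is_ideal V I"
  shows "I \<subseteq> polys_on V" "0 \<in> I" "a \<in> I \<Longrightarrow> b \<in> I \<Longrightarrow> a + b \<in> I"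
    "a \<in> I \<Longrightarrow> r \<in> polys_on V \<Longrightarrow> r * a \<in> I"
  using assms by (auto simp: is_ideal_def)

lemma is_ideal_uminus:
  assumes "is_ideal V (I :: ('v, 'k::comm_ring_1) mpoly set)" "a \<in> I"
  shows "- a \<in> I"
  using is_idealD(4)[OF assms, of "- 1"] polys_on_uminus[of 1 V] by simp

lemma is_ideal_diff:
  assumes "is_ideal V (I :: ('v, 'k::comm_ring_1) mpoly set)" "a \<in> I" "b \<in> I"
  shows "a - b \<in> I"
  using is_idealD(3)[OF assms(1,2) is_ideal_uminus[OF assms(1,3)]] by simp

lemma is_ideal_sum:
  assumes "is_ideal V (I :: ('v, 'k::comm_ring_1) mpoly set)"
  shows "(\<And>i. i \<in> F \<Longrightarrow> f i \<in> I) \<Longrightarrow> sum f F \<in> I"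
  by (induction F rule: infinite_finite_induct) (auto intro: is_idealD[OF assms])

lemma gen_ideal_least:
  assumes "is_ideal V I" "B \<subseteq> I"
  shows "gen_ideal V B \<subseteq> I"
proof
  fix p assume "p \<in> gen_ideal V B"
  then obtain F c where "F \<subseteq> B" "\<forall>b\<in>F. c b \<in> polys_on V" "p = (\<Sum>b\<in>F. c b * b)"
    unfolding gen_ideal_def by blast
  then show "p \<in> I"
    using is_ideal_sum[OF assms(1), of F "\<lambda>b. c b * b"] is_idealD(4)[OF assms(1)] assms(2)
    by (simp add: subset_iff)
qed

lemma gen_ideal_superset: "B \<subseteq> gen_ideal V B"
proof
  fix b assume "b \<in> B"
  then show "b \<in> gen_ideal V B"
    unfolding gen_ideal_def
    by (intro CollectI exI[of _ "{b}"] exI[of _ "\<lambda>_. 1"]) auto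
qed

lemma gen_ideal_is_ideal:
  fixes B :: "('v, 'k::comm_ring_1) mpoly set"
  assumes "B \<subseteq> polys_on V"
  shows "is_ideal V (gen_ideal V B)"
  unfolding is_ideal_def
proof (intro conjI ballI)
  show "gen_ideal V B \<subseteq> polys_on V"
    unfolding gen_ideal_def using assms by (auto intro!: polys_on_sum polys_on_mult)
  show "0 \<in> gen_ideal V B"
    unfolding gen_ideal_def by (intro CollectI exI[of _ "{}"]) auto
next
  fix p q assume "p \<in> gen_ideal V B" "q \<in> gen_ideal V B"
  then obtain F c G d where
    F: "finite F" "F \<subseteq> B" "\<forall>b\<in>F. c b \<in> polys_on V" "p = (\<Sum>b\<in>F. c b * b)" and
    G: "finite G" "G \<subseteq> B" "\<forall>b\<in>G. d b \<in> polys_on V" "q = (\<Sum>b\<in>G. d b * b)"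
    unfolding gen_ideal_def by blast
  define e where "e b = (if b \<in> F then c b else 0) + (if b \<in> G then d b else 0)" for b
  have "p = (\<Sum>b\<in>F \<union> G. (if b \<in> F then c b else 0) * b)"
    unfolding F(4) using F(1) G by (intro sum.mono_neutral_cong_left) auto
  moreover have "q = (\<Sum>b\<in>F \<union> G. (if b \<in> G then d b else 0) * b)"
    unfolding G(4) using F(1) G by (intro sum.mono_neutral_cong_left) auto
  ultimately have "p + q = (\<Sum>b\<in>F \<union> G. e b * b)"
    by (simp add: e_def sum.distrib distrib_right)
  moreover have "\<forall>b\<in>F \<union> G. e b \<in> polys_on V"
    using F(3) G(3) by (auto simp: e_def intro: polys_on_add)
  ultimately show "p + q \<in> gen_ideal V B"
    unfolding gen_ideal_def using F(1,2) G(1,2)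
    by (intro CollectI exI[of _ "F \<union> G"] exI[of _ e]) auto
next
  fix p r :: "('v, 'k) mpoly" assume "p \<in> gen_ideal V B" and r: "r \<in> polys_on V"
  then obtain F c where
    F: "finite F" "F \<subseteq> B" "\<forall>b\<in>F. c b \<in> polys_on V" "p = (\<Sum>b\<in>F. c b * b)"
    unfolding gen_ideal_def by blast
  then have "r * p = (\<Sum>b\<in>F. (r * c b) * b)"
    by (simp add: sum_distrib_left mult.assoc)
  then show "r * p \<in> gen_ideal V B"
    unfolding gen_ideal_def using F(1,2,3) r
    by (intro CollectI exI[of _ F] exI[of _ "\<lambda>b. r * c b"]) (auto intro: polys_on_mult)
qed

section \<open>Prime ideals and their existence\<close>

lemma prime_idealD:
  assumes "prime_ideal V (P :: ('v, 'k::comm_ring_1) mpoly set)"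
  shows "is_ideal V P" "1 \<notin> P"
    "a \<in> polys_on V \<Longrightarrow> b \<in> polys_on V \<Longrightarrow> a * b \<in> P \<Longrightarrow> a \<in> P \<or> b \<in> P"
proof -
  show i: "is_ideal V P" using assms by (simp add: prime_ideal_def)
  show "1 \<notin> P"
  proof
    assume "1 \<in> P"
    then have "polys_on V \<subseteq> P" using is_idealD(4)[OF i, of 1] by auto
    then show False using assms is_idealD(1)[OF i] by (auto simp: prime_ideal_def)
  qed
  show "a \<in> polys_on V \<Longrightarrow> b \<in> polys_on V \<Longrightarrow> a * b \<in> P \<Longrightarrow> a \<in> P \<or> b \<in> P"
    using assms by (auto simp: prime_ideal_def)
qed

lemma prime_ideal_power:
  fixes a :: "('v, 'k::comm_ring_1) mpoly"
  assumes "prime_ideal V P" "a \<in> polys_on V" "a ^ n \<in> P"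
  shows "a \<in> P"
  using assms(3)
proof (induction n)
  case 0
  then show ?case using prime_idealD(2)[OF assms(1)] by simp
next
  case (Suc n)
  then show ?case
    using prime_idealD(3)[OF assms(1,2) polys_on_power[OF assms(2), of n]] by auto
qed

lemma is_ideal_add_principal:
  fixes a :: "('v, 'k::comm_ring_1) mpoly"
  assumes "is_ideal V Q" "a \<in> polys_on V"
  shows "is_ideal V {q + r * a | q r. q \<in> Q \<and> r \<in> polys_on V}" (is "is_ideal V ?N")
  unfolding is_ideal_def
proof (intro conjI ballI)
  note Q = is_idealD[OF assms(1)]
  show "?N \<subseteq> polys_on V"
    using Q(1) assms(2) by (auto intro!: polys_on_add polys_on_mult)
  show "0 \<in> ?N" using Q(2) by (intro CollectI exI[of _ 0]) auto
  fix x assume "x \<in> ?N"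
  then obtain q r where x: "x = q + r * a" "q \<in> Q" "r \<in> polys_on V" by blast
  { fix y assume "y \<in> ?N"
    then obtain q' r' where y: "y = q' + r' * a" "q' \<in> Q" "r' \<in> polys_on V" by blast
    have "x + y = (q + q') + (r + r') * a" using x y by (simp add: algebra_simps)
    then show "x + y \<in> ?N" using x y Q(3) polys_on_add by blast }
  fix s :: "('v, 'k) mpoly" assume s: "s \<in> polys_on V"
  have "s * x = s * q + (s * r) * a" using x by (simp add: algebra_simps)
  then show "s * x \<in> ?N" using x s Q(4) polys_on_mult by blast
qed

lemma is_ideal_Union_chain:
  fixes \<C> :: "('v, 'k::comm_ring_1) mpoly set set"
  assumes "\<C> \<noteq> {}" "\<And>I. I \<in> \<C> \<Longrightarrow> is_ideal V I"
    and chain: "\<And>I J. I \<in> \<C> \<Longrightarrow> J \<in> \<C> \<Longrightarrow> I \<subseteq> J \<or> J \<subseteq> I"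
  shows "is_ideal V (\<Union>\<C>)"
  unfolding is_ideal_def
proof (intro conjI ballI)
  show "\<Union>\<C> \<subseteq> polys_on V" using is_idealD(1)[OF assms(2)] by blast
  show "0 \<in> \<Union>\<C>" using assms(1) is_idealD(2)[OF assms(2)] by blast
  fix a assume "a \<in> \<Union>\<C>"
  then obtain I where I: "I \<in> \<C>" "a \<in> I" by blast
  { fix b assume "b \<in> \<Union>\<C>"
    then obtain J where J: "J \<in> \<C>" "b \<in> J" by blast
    show "a + b \<in> \<Union>\<C>"
      using chain[OF I(1) J(1)] I J is_idealD(3)[OF assms(2)] by blast }
  show "r * a \<in> \<Union>\<C>" if "r \<in> polys_on V" for r
    using I that is_idealD(4)[OF assms(2)] by blast
qed

text \<open>Zorn gives an ideal maximal among those avoiding \<open>S\<close>. If it contained the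
  product of \<open>a\<close> and \<open>b\<close> but neither factor, enlarging it by
  \<open>a\<close> and by \<open>b\<close> would meet \<open>S\<close> twice, and the product of the
  two elements found would lie both in the ideal and in \<open>S\<close>.\<close>

lemma prime_ideal_disjoint_exists:
  fixes J :: "('v, 'k::comm_ring_1) mpoly set"
  assumes J: "is_ideal V J" and S1: "1 \<in> S"
    and Smult: "\<And>s t. s \<in> S \<Longrightarrow> t \<in> S \<Longrightarrow> s * t \<in> S" and disj: "J \<inter> S = {}"
  obtains Q where "prime_ideal V Q" "J \<subseteq> Q" "Q \<inter> S = {}"
proof -
  define \<A> where "\<A> = {Q. is_ideal V Q \<and> J \<subseteq> Q \<and> Q \<inter> S = {}}"
  have "\<exists>M\<in>\<A>. \<forall>X\<in>\<A>. M \<subseteq> X \<longrightarrow> X = M"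
  proof (rule subset_Zorn_nonempty)
    show "\<A> \<noteq> {}" using J disj by (auto simp: \<A>_def)
    fix \<C> assume C: "\<C> \<noteq> {}" "subset.chain \<A> \<C>"
    then have sub: "\<C> \<subseteq> \<A>" and tot: "\<And>I K. I \<in> \<C> \<Longrightarrow> K \<in> \<C> \<Longrightarrow> I \<subseteq> K \<or> K \<subseteq> I"
      by (auto simp: subset_chain_def)
    have "is_ideal V (\<Union>\<C>)"
      using C(1) tot sub by (intro is_ideal_Union_chain) (auto simp: \<A>_def)
    then show "\<Union>\<C> \<in> \<A>" using C(1) sub by (auto simp: \<A>_def)
  qed
  then obtain Q where Q: "is_ideal V Q" "J \<subseteq> Q" "Q \<inter> S = {}"
    and max: "\<And>X. is_ideal V X \<Longrightarrow> J \<subseteq> X \<Longrightarrow> X \<inter> S = {} \<Longrightarrow> Q \<subseteq> X \<Longrightarrow> X = Q"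
    by (auto simp: \<A>_def)
  have meets: "\<exists>q r. q \<in> Q \<and> r \<in> polys_on V \<and> q + r * a \<in> S"
    if a: "a \<in> polys_on V" "a \<notin> Q" for a
  proof (rule ccontr)
    let ?N = "{q + r * a | q r. q \<in> Q \<and> r \<in> polys_on V}"
    assume "\<not> ?thesis"
    then have "?N \<inter> S = {}" by blast
    moreover have QN: "Q \<subseteq> ?N"
    proof
      fix q assume "q \<in> Q"
      then show "q \<in> ?N" by (intro CollectI exI[of _ q] exI[of _ 0]) auto
    qed
    ultimately have "?N = Q"
      using max[OF is_ideal_add_principal[OF Q(1) a(1)]] Q(2) by blast
    moreover have "a \<in> ?N"
      using is_idealD(2)[OF Q(1)] by (intro CollectI exI[of _ 0] exI[of _ 1]) auto
    ultimately show False using a(2) by blast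
  qed
  have "prime_ideal V Q"
    unfolding prime_ideal_def
  proof (intro conjI ballI impI)
    show "is_ideal V Q" by (fact Q(1))
    show "Q \<noteq> polys_on V" using S1 Q(3) polys_on_1 by blast
    fix a b assume a: "a \<in> polys_on V" and b: "b \<in> polys_on V" and ab: "a * b \<in> Q"
    show "a \<in> Q \<or> b \<in> Q"
    proof (rule ccontr)
      assume "\<not> ?thesis"
      then obtain q r q' r' where q: "q \<in> Q" "r \<in> polys_on V" "q + r * a \<in> S"
        and q': "q' \<in> Q" "r' \<in> polys_on V" "q' + r' * b \<in> S"
        using meets a b by meson
      have "(q + r * a) * (q' + r' * b) = (q' + r' * b) * q + ((r * a) * q' + (r * r') * (a * b))"
        by (simp add: algebra_simps)
      moreover have "\<dots> \<in> Q"
      proof (intro is_idealD(3)[OF Q(1)])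
        show "(q' + r' * b) * q \<in> Q"
          using q q' b is_idealD(1)[OF Q(1)]
          by (intro is_idealD(4)[OF Q(1)] polys_on_add polys_on_mult) auto
        show "(r * a) * q' \<in> Q" "(r * r') * (a * b) \<in> Q"
          using q q' a ab by (auto intro!: is_idealD(4)[OF Q(1)] polys_on_mult)
      qed
      ultimately show False using Smult[OF q(3) q'(3)] Q(3) by auto
    qed
  qed
  then show thesis using that Q by blast
qed

lemma prime_ideal_below_nonzerodivisor:
  fixes f :: "('v, 'k::comm_ring_1) mpoly"
  assumes J: "is_ideal V J" and P: "prime_ideal V P" "J \<subseteq> P" and f: "f \<in> P"
    and nzd: "\<And>g. g \<in> polys_on V \<Longrightarrow> f * g \<in> J \<Longrightarrow> g \<in> J"
  obtains Q where "prime_ideal V Q" "J \<subseteq> Q" "Q \<subset> P"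
proof -
  \<comment> \<open>The prime avoids both the complement of P and the powers of f, so it misses f.\<close>
  define S where "S = {s * f ^ k | s k. s \<in> polys_on V \<and> s \<notin> P}"
  have fV: "f \<in> polys_on V" using f P is_idealD(1) prime_idealD(1) by blast
  have 1: "s * f ^ k \<in> S" if "s \<in> polys_on V" "s \<notin> P" for s k
    using that by (auto simp: S_def)
  \<comment> \<open>Cancelling the factors \<open>f\<close> one at a time leads from
    \<open>s * f ^ k \<in> J\<close> to \<open>s \<in> J \<subseteq> P\<close>, so no element of
    \<open>S\<close> lies in \<open>J\<close>.\<close>
  have powers: "s \<in> J" if "s \<in> polys_on V" "s * f ^ k \<in> J" for s k
    using that(2)
  proof (induction k)
    case (Suc k)
    then show ?case
      using nzd[of "s * f ^ k"] polys_on_mult[OF that(1) polys_on_power[OF fV]]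
      by (simp add: ac_simps)
  qed simp
  have "1 \<in> S" using 1[of 1 0] prime_idealD(2)[OF P(1)] by simp
  moreover have "x * y \<in> S" if xy: "x \<in> S" "y \<in> S" for x y
  proof -
    obtain s k t l where x: "x = s * f ^ k" "s \<in> polys_on V" "s \<notin> P"
      and y: "y = t * f ^ l" "t \<in> polys_on V" "t \<notin> P"
      using xy by (auto simp: S_def)
    have "x * y = (s * t) * f ^ (k + l)" using x y by (simp add: power_add ac_simps)
    then show ?thesis
      using 1[of "s * t"] x y prime_idealD(3)[OF P(1)] polys_on_mult by metis
  qed
  moreover have "J \<inter> S = {}" using powers P(2) by (auto simp: S_def)
  ultimately obtain Q where Q: "prime_ideal V Q" "J \<subseteq> Q" "Q \<inter> S = {}"
    using prime_ideal_disjoint_exists[OF J] by metis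
  have "Q \<subseteq> P"
  proof
    fix q assume q: "q \<in> Q"
    then have "q \<in> polys_on V" using is_idealD(1)[OF prime_idealD(1)[OF Q(1)]] by blast
    then show "q \<in> P" using 1[of q 0] Q(3) q by auto
  qed
  moreover have "f \<notin> Q" using 1[of 1 1] prime_idealD(2)[OF P(1)] Q(3) by auto
  ultimately show thesis using that Q f by blast
qed

text \<open>A prime over the last ideal starts the chain at its top. Each element of the sequence,
  taken from the last to the first, is a nonzerodivisor modulo the ideal before it and so forces a
  strictly smaller prime over that ideal.\<close>

lemma regular_seq_prime_chain:
  fixes I :: "('v, 'k::comm_ring_1) mpoly set"
  assumes I: "I \<subseteq> polys_on V" and reg: "regular_seq V I fs"
  shows "\<exists>P. (\<forall>i\<le>length fs. prime_ideal V (P i) \<and> I \<subseteq> P i) \<and> (\<forall>i<length fs. P i \<subset> P (Suc i))"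
proof -
  define J where "J i = gen_ideal V (I \<union> set (take i fs))" for i
  let ?n = "length fs"
  have "var ` V \<subseteq> (polys_on V :: ('v, 'k) mpoly set)" by (auto intro: var_polys_on)
  then have "(irrelevant_ideal V :: ('v, 'k) mpoly set) \<subseteq> polys_on V"
    unfolding irrelevant_ideal_def by (rule is_idealD(1)[OF gen_ideal_is_ideal])
  moreover have "set fs \<subseteq> irrelevant_ideal V" using reg unfolding regular_seq_def by (rule conjunct1)
  ultimately have fs: "set fs \<subseteq> polys_on V" by (rule subset_trans[rotated])
  have proper: "J ?n \<noteq> polys_on V"
    using reg unfolding regular_seq_def J_def by simp
  have Jsub: "I \<union> set (take i fs) \<subseteq> polys_on V" for i
    using I fs set_take_subset[of i fs] by blast
  have J: "is_ideal V (J i)" for i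
    unfolding J_def by (rule gen_ideal_is_ideal[OF Jsub])
  have Jsup: "I \<union> set (take i fs) \<subseteq> J i" for i unfolding J_def by (rule gen_ideal_superset)
  \<comment> \<open>The index counts from the end: \<open>k\<close> elements have been used, and the
    chain lies over the ideal of the first \<open>?n - k\<close>.\<close>
  have "k \<le> ?n \<Longrightarrow> \<exists>P. (\<forall>i\<le>k. prime_ideal V (P i) \<and> J (?n - k) \<subseteq> P i) \<and> (\<forall>i<k. P i \<subset> P (Suc i))" for k
  proof (induction k)
    case 0
    have "1 \<notin> J ?n"
    proof
      assume "1 \<in> J ?n"
      then have "polys_on V \<subseteq> J ?n" using is_idealD(4)[OF J, of 1 ?n] by auto
      then show False using proper is_idealD(1)[OF J, of ?n] by (simp add: subset_antisym)
    qed
    then obtain Q where "prime_ideal V Q" "J ?n \<subseteq> Q"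
      using prime_ideal_disjoint_exists[OF J, of "{1}" ?n] by auto
    then show ?case by (intro exI[of _ "\<lambda>_. Q"]) auto
  next
    case (Suc k)
    then obtain P where P: "\<And>i. i \<le> k \<Longrightarrow> prime_ideal V (P i) \<and> J (?n - k) \<subseteq> P i"
      "\<And>i. i < k \<Longrightarrow> P i \<subset> P (Suc i)" by auto
    define j where "j = ?n - Suc k"
    have j: "j < ?n" "?n - k = Suc j" using Suc.prems by (auto simp: j_def)
    have "fs ! j \<in> P 0"
      using Jsup[of "Suc j"] P(1)[of 0] j by (auto simp: take_Suc_conv_app_nth)
    moreover have "J j \<subseteq> J (Suc j)"
      unfolding J_def[of j]
      by (rule gen_ideal_least[OF J])
        (use Jsup[of "Suc j"] in \<open>auto simp: take_Suc_conv_app_nth j\<close>)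
    then have "J j \<subseteq> P 0" using P(1)[of 0] j(2) by auto
    moreover have "\<And>g. g \<in> polys_on V \<Longrightarrow> fs ! j * g \<in> J j \<Longrightarrow> g \<in> J j"
      using reg j(1) unfolding regular_seq_def J_def by blast
    moreover have "prime_ideal V (P 0)" using P(1)[of 0] by simp
    ultimately obtain Q where Q: "prime_ideal V Q" "J j \<subseteq> Q" "Q \<subset> P 0"
      using prime_ideal_below_nonzerodivisor[OF J, of "P 0" j "fs ! j"] by blast
    define P' where "P' i = (case i of 0 \<Rightarrow> Q | Suc i \<Rightarrow> P i)" for i
    have "prime_ideal V (P' i) \<and> J j \<subseteq> P' i" if "i \<le> Suc k" for i
    proof (cases i)
      case (Suc l)
      then show ?thesis using that P(1)[of l] \<open>J j \<subseteq> J (Suc j)\<close> j(2) by (auto simp: P'_def)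
    qed (use Q in \<open>simp add: P'_def\<close>)
    moreover have "P' i \<subset> P' (Suc i)" if "i < Suc k" for i
    proof (cases i)
      case (Suc l)
      then show ?thesis using that P(2)[of l] by (simp add: P'_def)
    qed (use Q in \<open>simp add: P'_def\<close>)
    ultimately show ?case unfolding j_def by blast
  qed
  from this[of ?n] obtain P
    where P: "\<forall>i\<le>?n. prime_ideal V (P i) \<and> J 0 \<subseteq> P i" "\<forall>i<?n. P i \<subset> P (Suc i)"
    unfolding diff_self_eq_0 by blast
  have IJ: "I \<subseteq> J 0" using Jsup[of 0] by simp
  show ?thesis
    by (rule exI[of _ P]) (use P IJ in \<open>meson subset_trans\<close>)
qed

subsection \<open>Bounding chains of primes\<close>

lemma prime_ideal_const_notin:
  assumes "prime_ideal V (P :: ('v, 'k::field) mpoly set)" "c \<noteq> 0"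
  shows "Poly_Mapping.single 0 c \<notin> P"
proof
  assume "Poly_Mapping.single 0 c \<in> P"
  then have "Poly_Mapping.single 0 (inverse c) * Poly_Mapping.single 0 c \<in> P"
    by (intro is_idealD(4)[OF prime_idealD(1)[OF assms(1)]]) auto
  then show False using assms prime_idealD(2)[OF assms(1)] by (simp add: mult_single)
qed

text \<open>Elements picked from the successive differences of a chain of primes are algebraically
  independent modulo the bottom prime: divide a relation by the lowest power of the first element,
  then reduce modulo the next prime.\<close>

lemma prime_chain_independent:
  fixes P :: "nat \<Rightarrow> ('v, 'k::field) mpoly set" and ex :: "'i \<Rightarrow> nat \<Rightarrow> nat"
  assumes "\<And>i. i \<le> m \<Longrightarrow> prime_ideal V (P i)"
    and "\<And>i. i < m \<Longrightarrow> P i \<subseteq> P (Suc i) \<and> f i \<in> P (Suc i) \<and> f i \<notin> P i"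
    and "finite S" "S \<noteq> {}" "\<And>s. s \<in> S \<Longrightarrow> c s \<noteq> 0"
    and "\<And>s t. s \<in> S \<Longrightarrow> t \<in> S \<Longrightarrow> (\<And>i. i < m \<Longrightarrow> ex s i = ex t i) \<Longrightarrow> s = t"
  shows "(\<Sum>s\<in>S. Poly_Mapping.single 0 (c s) * (\<Prod>i<m. f i ^ ex s i)) \<notin> P 0"
  using assms
proof (induction m arbitrary: P f S ex)
  case 0
  \<comment> \<open>With no \<open>f i\<close> at all, distinctness of the exponent vectors leaves a
    single nonzero constant, a unit.\<close>
  from 0(4) obtain s where "s \<in> S" by blast
  with 0(6) have "S = {s}" by blast
  then show ?case using prime_ideal_const_notin[OF 0(1)[of 0], of "c s"] 0(5) by simp
next
  case (Suc m)
  note prime = Suc.prems(1) and step = Suc.prems(2) and fin = Suc.prems(3)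
  define d where "d = Min ((\<lambda>s. ex s 0) ` S)"
  have d_le: "d \<le> ex s 0" if "s \<in> S" for s
    unfolding d_def using fin that by auto
  have "d \<in> (\<lambda>s. ex s 0) ` S" unfolding d_def using fin Suc.prems(4) by (intro Min_in) auto
  then obtain s0 where s0: "s0 \<in> S" "ex s0 0 = d" by blast
  \<comment> \<open>The terms that survive modulo \<open>P 1\<close> after division by
    \<open>f 0 ^ d\<close>; all others keep a factor \<open>f 0\<close>, which lies in
    \<open>P 1\<close>.\<close>
  define S' where "S' = {s \<in> S. ex s 0 = d}"
  define g where "g s = Poly_Mapping.single 0 (c s) * (\<Prod>i<m. f (Suc i) ^ ex s (Suc i))" for s
  have f_V: "f i \<in> polys_on V" if "i < Suc m" for i
    using step[OF that] is_idealD(1)[OF prime_idealD(1)[OF prime[of "Suc i"]]] that by auto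
  have g_V: "g s \<in> polys_on V" for s
    unfolding g_def using f_V by (intro polys_on_mult polys_on_prod polys_on_power) auto
  have eq: "Poly_Mapping.single 0 (c s) * (\<Prod>i<Suc m. f i ^ ex s i) = f 0 ^ d * (f 0 ^ (ex s 0 - d) * g s)"
    if "s \<in> S" for s
  proof -
    have "f 0 ^ ex s 0 = f 0 ^ d * f 0 ^ (ex s 0 - d)"
      using d_le[OF that] by (simp flip: power_add)
    then show ?thesis
      unfolding prod.lessThan_Suc_shift g_def by (simp add: ac_simps)
  qed
  have P0: "prime_ideal V (P 0)" and P1: "is_ideal V (P 1)"
    using prime[of 0] prime_idealD(1)[OF prime[of 1]] by auto
  let ?T = "\<Sum>s\<in>S. f 0 ^ (ex s 0 - d) * g s"
  have "?T \<notin> P 0"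
  proof
    assume "?T \<in> P 0"
    then have "?T \<in> P 1" using step[of 0] by auto
    moreover have "?T = (\<Sum>s\<in>S'. g s) + (\<Sum>s\<in>S - S'. f 0 ^ (ex s 0 - d) * g s)"
    proof -
      have "?T = (\<Sum>s\<in>S'. f 0 ^ (ex s 0 - d) * g s) + (\<Sum>s\<in>S - S'. f 0 ^ (ex s 0 - d) * g s)"
        using fin by (subst sum.subset_diff[of S' S]) (auto simp: S'_def add.commute)
      then show ?thesis by (simp add: S'_def)
    qed
    moreover have "(\<Sum>s\<in>S - S'. f 0 ^ (ex s 0 - d) * g s) \<in> P 1"
    proof (rule is_ideal_sum[OF P1])
      fix s assume "s \<in> S - S'"
      then have "ex s 0 - d \<noteq> 0" using d_le[of s] by (auto simp: S'_def)
      then obtain e where "ex s 0 - d = Suc e" by (cases "ex s 0 - d") auto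
      then have "f 0 ^ (ex s 0 - d) * g s = (f 0 ^ e * g s) * f 0" by (simp add: ac_simps)
      also have "\<dots> \<in> P 1"
        using step[of 0] f_V[of 0] g_V[of s]
        by (intro is_idealD(4)[OF P1] polys_on_mult polys_on_power) auto
      finally show "f 0 ^ (ex s 0 - d) * g s \<in> P 1" .
    qed
    ultimately have "(\<Sum>s\<in>S'. g s) \<in> P 1"
      using is_ideal_diff[OF P1, of ?T "\<Sum>s\<in>S - S'. f 0 ^ (ex s 0 - d) * g s"] by simp
    moreover have "(\<Sum>s\<in>S'. g s) \<notin> P (Suc 0)"
      unfolding g_def
    proof (rule Suc.IH[of "\<lambda>i. P (Suc i)" "\<lambda>i. f (Suc i)" S' "\<lambda>s i. ex s (Suc i)"])
      show "finite S'" "S' \<noteq> {}" using fin s0 by (auto simp: S'_def)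
      \<comment> \<open>All terms of \<open>S'\<close> share the exponent \<open>d\<close> at index
        0, so agreement on the shifted indices is agreement everywhere.\<close>
      show "s = t" if "s \<in> S'" "t \<in> S'" "\<And>i. i < m \<Longrightarrow> ex s (Suc i) = ex t (Suc i)" for s t
      proof (rule Suc.prems(6))
        show "ex s i = ex t i" if "i < Suc m" for i
          using that \<open>s \<in> S'\<close> \<open>t \<in> S'\<close> \<open>\<And>i. i < m \<Longrightarrow> ex s (Suc i) = ex t (Suc i)\<close>
          by (cases i) (auto simp: S'_def)
      qed (use that in \<open>auto simp: S'_def\<close>)
    qed (use prime step Suc.prems(5) in \<open>auto simp: S'_def\<close>)
    ultimately show False by simp
  qed
  moreover have "f 0 ^ d \<notin> P 0"
    using prime_ideal_power[OF P0 f_V[of 0]] step[of 0] by auto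
  moreover have "?T \<in> polys_on V"
    using f_V[of 0] g_V by (intro polys_on_sum polys_on_mult polys_on_power) auto
  ultimately have "f 0 ^ d * ?T \<notin> P 0"
    using prime_idealD(3)[OF P0 polys_on_power[OF f_V[of 0]], of ?T d] by auto
  then show ?case
    using eq by (simp add: sum_distrib_left cong: sum.cong)
qed

text \<open>The bound is on each exponent and not on the total degree: the admissible monomials then
  number at most \<open>Suc N ^ card W\<close>, and bounds add under multiplication.\<close>

definition bounded_on :: "'v set \<Rightarrow> nat \<Rightarrow> ('v, 'k::zero) mpoly \<Rightarrow> bool" where
  "bounded_on W N p \<longleftrightarrow>
    (\<forall>\<mu>\<in>Poly_Mapping.keys p. Poly_Mapping.keys \<mu> \<subseteq> W \<and> (\<forall>v. Poly_Mapping.lookup \<mu> v \<le> N))"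

lemma bounded_on_mult:
  fixes p q :: "('v, 'k::comm_ring_1) mpoly"
  assumes "bounded_on W M p" "bounded_on W N q"
  shows "bounded_on W (M + N) (p * q)"
  unfolding bounded_on_def
proof
  fix m assume "m \<in> Poly_Mapping.keys (p * q)"
  then obtain a b where ab: "a \<in> Poly_Mapping.keys p" "b \<in> Poly_Mapping.keys q" "m = a + b"
    by (rule keys_mult_expo)
  then have "Poly_Mapping.keys a \<subseteq> W" "Poly_Mapping.keys b \<subseteq> W"
    "\<And>v. Poly_Mapping.lookup a v \<le> M" "\<And>v. Poly_Mapping.lookup b v \<le> N"
    using assms unfolding bounded_on_def by blast+
  then show "Poly_Mapping.keys m \<subseteq> W \<and> (\<forall>v. Poly_Mapping.lookup m v \<le> M + N)"
    using ab(3) keys_add[of a b] by (auto simp: lookup_add add_mono)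
qed

lemma bounded_on_1: "bounded_on W N (1 :: ('v, 'k::comm_ring_1) mpoly)"
  by (simp add: bounded_on_def)

lemma bounded_on_mono: "bounded_on W M p \<Longrightarrow> M \<le> N \<Longrightarrow> bounded_on W N p"
  unfolding bounded_on_def by (meson le_trans)

lemma bounded_on_power:
  fixes p :: "('v, 'k::comm_ring_1) mpoly"
  assumes "bounded_on W M p"
  shows "bounded_on W (n * M) (p ^ n)"
  by (induction n) (auto intro: bounded_on_1 bounded_on_mult[OF assms])

lemma bounded_on_prod:
  fixes f :: "'i \<Rightarrow> ('v, 'k::comm_ring_1) mpoly"
  assumes "\<And>i. i \<in> F \<Longrightarrow> bounded_on W M (f i)"
  shows "bounded_on W (card F * M) (prod f F)"
  using assms
  by (induction F rule: infinite_finite_induct) (auto intro: bounded_on_1 bounded_on_mult)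

lemma bounded_on_exists:
  assumes "p \<in> polys_on W"
  shows "\<exists>N. bounded_on W N p"
proof -
  let ?A = "\<Union>\<mu>\<in>Poly_Mapping.keys p. Poly_Mapping.lookup \<mu> ` Poly_Mapping.keys \<mu>"
  have "Poly_Mapping.lookup \<mu> v \<le> Max (insert 0 ?A)" if "\<mu> \<in> Poly_Mapping.keys p" for \<mu> v
    using that by (cases "v \<in> Poly_Mapping.keys \<mu>") (auto intro!: Max_ge simp: in_keys_iff)
  then show ?thesis using assms unfolding bounded_on_def polys_on_def by blast
qed

lemma card_bounded_exponents:
  fixes N :: nat
  assumes "finite W"
  defines "M \<equiv> {\<mu> :: 'v \<Rightarrow>\<^sub>0 nat. Poly_Mapping.keys \<mu> \<subseteq> W \<and> (\<forall>v. Poly_Mapping.lookup \<mu> v \<le> N)}"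
  shows "finite M" "card M \<le> Suc N ^ card W"
proof -
  let ?X = "W \<rightarrow>\<^sub>E {..N}"
  have sub: "(\<lambda>\<mu>. restrict (Poly_Mapping.lookup \<mu>) W) ` M \<subseteq> ?X"
    by (auto simp: M_def)
  have inj: "inj_on (\<lambda>\<mu>. restrict (Poly_Mapping.lookup \<mu>) W) M"
  proof (rule inj_onI)
    fix \<mu> \<nu> assume *: "\<mu> \<in> M" "\<nu> \<in> M" "restrict (Poly_Mapping.lookup \<mu>) W = restrict (Poly_Mapping.lookup \<nu>) W"
    show "\<mu> = \<nu>"
    proof (rule poly_mapping_eqI)
      fix v
      show "Poly_Mapping.lookup \<mu> v = Poly_Mapping.lookup \<nu> v"
      proof (cases "v \<in> W")
        case True
        then show ?thesis using fun_cong[OF *(3), of v] by simp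
      next
        case False
        then have "v \<notin> Poly_Mapping.keys \<mu>" "v \<notin> Poly_Mapping.keys \<nu>" using * by (auto simp: M_def)
        then show ?thesis by (simp add: in_keys_iff)
      qed
    qed
  qed
  have "finite ?X" using assms by (simp add: finite_PiE)
  then show "finite M" using finite_subset[OF sub] inj by (simp add: finite_image_iff)
  show "card M \<le> Suc N ^ card W"
    using card_inj_on_le[OF inj sub \<open>finite ?X\<close>] assms by (simp add: card_PiE)
qed

text \<open>Linear algebra serves to compare the size of an independent set with that of a finite
  spanning set; scalars act through constant polynomials.\<close>

interpretation mpoly_vs: vector_space "\<lambda>(c :: 'k::field) (p :: ('v, 'k) mpoly). Poly_Mapping.single 0 c * p"
  by standard (simp_all add: distrib_left distrib_right single_add mult_single flip: mult.assoc)

lemma poly_mapping_sum_single: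
  "(p :: 'a \<Rightarrow>\<^sub>0 'b::comm_monoid_add) = (\<Sum>m\<in>Poly_Mapping.keys p. Poly_Mapping.single m (Poly_Mapping.lookup p m))"
  by (rule poly_mapping_eqI) (auto simp: lookup_sum lookup_single in_keys_iff when_def sum.delta)

text \<open>The \<open>d ^ m\<close> products of the \<open>f i\<close> with exponents below
  \<open>d\<close> are linearly independent, since a relation would put a nontrivial combination
  into \<open>P 0\<close>. They lie in the span of the monomials over \<open>W\<close> with
  exponents at most \<open>m * (d * D)\<close>, and the right-hand side bounds the number of
  these.\<close>

lemma prime_chain_count:
  fixes P :: "nat \<Rightarrow> ('v, 'k::field) mpoly set"
  assumes prime: "\<And>i. i \<le> m \<Longrightarrow> prime_ideal V (P i)"
    and step: "\<And>i. i < m \<Longrightarrow> P i \<subseteq> P (Suc i) \<and> f i \<in> P (Suc i) \<and> f i \<notin> P i"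
    and W: "finite W" and f: "\<And>i. i < m \<Longrightarrow> bounded_on W D (f i)"
  shows "d ^ m \<le> Suc (m * (d * D)) ^ card W"
proof -
  let ?N = "m * (d * D)"
  define M where "M = {\<mu> :: 'v \<Rightarrow>\<^sub>0 nat. Poly_Mapping.keys \<mu> \<subseteq> W \<and> (\<forall>v. Poly_Mapping.lookup \<mu> v \<le> ?N)}"
  define T :: "('v, 'k) mpoly set" where "T = (\<lambda>\<mu>. Poly_Mapping.single \<mu> 1) ` M"
  let ?X = "{..<m} \<rightarrow>\<^sub>E {..<d}"
  define F where "F e = (\<Prod>i<m. f i ^ e i)" for e
  have M: "finite M" "card M \<le> Suc ?N ^ card W"
    unfolding M_def by (rule card_bounded_exponents[OF W])+
  have X: "finite ?X" "card ?X = d ^ m" by (simp_all add: finite_PiE card_PiE)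
  have ext: "e = e'" if "e \<in> ?X" "e' \<in> ?X" "\<And>i. i < m \<Longrightarrow> e i = e' i" for e e'
    by (rule PiE_ext[OF that(1,2)]) (simp add: that(3))
  have nz: "(\<Sum>e\<in>S. Poly_Mapping.single 0 (c e) * F e) \<noteq> 0"
    if "S \<subseteq> ?X" "S \<noteq> {}" "\<And>e. e \<in> S \<Longrightarrow> c e \<noteq> 0" for S c
  proof -
    have "(\<Sum>e\<in>S. Poly_Mapping.single 0 (c e) * F e) \<notin> P 0"
      unfolding F_def
    proof (rule prime_chain_independent[where ex = "\<lambda>e. e" and c = c and P = P and f = f and m = m, OF prime step finite_subset[OF that(1) X(1)] that(2,3)])
      show "s = t" if "s \<in> S" "t \<in> S" "\<And>i. i < m \<Longrightarrow> s i = t i" for s t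
        using ext[of s t] that \<open>S \<subseteq> ?X\<close> by blast
    qed
    then show ?thesis using is_idealD(2)[OF prime_idealD(1)[OF prime[of 0]]] by auto
  qed
  \<comment> \<open>Two coinciding products would give a relation with coefficients 1 and
    -1.\<close>
  have inj: "inj_on F ?X"
  proof (rule inj_onI, rule ccontr)
    fix e e' assume *: "e \<in> ?X" "e' \<in> ?X" "F e = F e'" "e \<noteq> e'"
    let ?c = "\<lambda>x. if x = e then 1 else - 1 :: 'k"
    have "(\<Sum>x\<in>{e, e'}. Poly_Mapping.single 0 (?c x) * F x) \<noteq> 0"
      using * by (intro nz) auto
    then show False using * by (simp add: single_uminus)
  qed
  have "mpoly_vs.independent (F ` ?X)"
    unfolding mpoly_vs.independent_explicit_module
  proof (intro allI impI)
    fix T' u and v :: "('v, 'k) mpoly"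
    assume T': "finite T'" "T' \<subseteq> F ` ?X" "(\<Sum>v\<in>T'. Poly_Mapping.single 0 (u v) * v) = 0" "v \<in> T'"
    define S where "S = {e \<in> ?X. F e \<in> T' \<and> u (F e) \<noteq> 0}"
    have "(\<Sum>v\<in>T'. Poly_Mapping.single 0 (u v) * v) = (\<Sum>v\<in>F ` S. Poly_Mapping.single 0 (u v) * v)"
      using T'(1,2) by (intro sum.mono_neutral_right) (auto simp: S_def)
    also have "\<dots> = (\<Sum>e\<in>S. Poly_Mapping.single 0 (u (F e)) * F e)"
      by (rule sum.reindex_cong[of F, OF inj_on_subset[OF inj]]) (simp_all add: S_def)
    finally have sum0: "(\<Sum>e\<in>S. Poly_Mapping.single 0 (u (F e)) * F e) = 0" using T'(3) by simp
    have "S \<subseteq> ?X" "\<And>e. e \<in> S \<Longrightarrow> u (F e) \<noteq> 0" by (simp_all add: S_def)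
    then have "S = {}" using nz[of S "\<lambda>e. u (F e)"] sum0 by blast
    moreover obtain e where "e \<in> ?X" "v = F e" using T'(2,4) by blast
    ultimately have "\<not> (F e \<in> T' \<and> u (F e) \<noteq> 0)" unfolding S_def by simp
    then show "u v = 0" using T'(4) \<open>v = F e\<close> by simp
  qed
  moreover have "F ` ?X \<subseteq> mpoly_vs.span T"
  proof (rule image_subsetI)
    fix e assume e: "e \<in> ?X"
    have "bounded_on W (card {..<m} * (d * D)) (F e)"
      unfolding F_def
    proof (rule bounded_on_prod)
      fix i assume "i \<in> {..<m}"
      then have "e i \<le> d" "bounded_on W (e i * D) (f i ^ e i)"
        using PiE_mem[OF e, of i] bounded_on_power[OF f[of i], of "e i"] by simp_all
      then show "bounded_on W (d * D) (f i ^ e i)"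
        using bounded_on_mono mult_le_mono1 by blast
    qed
    then have keys: "Poly_Mapping.keys (F e) \<subseteq> M" by (auto simp: bounded_on_def M_def)
    have "F e = (\<Sum>\<mu>\<in>Poly_Mapping.keys (F e). Poly_Mapping.single 0 (Poly_Mapping.lookup (F e) \<mu>) * Poly_Mapping.single \<mu> 1)"
      by (subst poly_mapping_sum_single) (simp add: mult_single)
    also have "\<dots> \<in> mpoly_vs.span T"
      using keys by (intro mpoly_vs.span_sum mpoly_vs.span_scale mpoly_vs.span_base) (auto simp: T_def)
    finally show "F e \<in> mpoly_vs.span T" .
  qed
  moreover have "finite T" using M by (simp add: T_def)
  ultimately have "card (F ` ?X) \<le> card T" using mpoly_vs.independent_span_bound by blast
  also have "\<dots> \<le> card M" unfolding T_def by (rule card_image_le[OF M(1)])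
  finally show ?thesis using M(2) X(2) card_image[OF inj] by simp
qed

text \<open>A monomial divisible by a variable of \<open>P\<close> lies in \<open>P\<close>, so
  deleting all such monomials changes \<open>p\<close> only modulo \<open>P\<close>.\<close>

lemma ideal_reduce:
  fixes P :: "('v, 'k::field) mpoly set"
  assumes P: "is_ideal V P" and p: "p \<in> polys_on V"
  defines "W \<equiv> {v \<in> V. var v \<notin> P}"
  obtains q where "q \<in> polys_on W" "p - q \<in> P"
proof -
  define K where "K = {m \<in> Poly_Mapping.keys p. Poly_Mapping.keys m \<subseteq> W}"
  define mon where "mon m = Poly_Mapping.single m (Poly_Mapping.lookup p m)" for m
  have "mon m \<in> P" if m: "m \<in> Poly_Mapping.keys p - K" for m
  proof -
    have mV: "Poly_Mapping.keys m \<subseteq> V" using m polys_onD[OF p] by blast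
    then obtain v where v: "v \<in> Poly_Mapping.keys m" "var v \<in> P"
      using m by (auto simp: K_def W_def)
    have "m = (m - expo v) + expo v"
      using v(1) by (intro poly_mapping_eqI) (auto simp: lookup_add lookup_minus lookup_single when_def in_keys_iff)
    then have "mon m = Poly_Mapping.single (m - expo v) (Poly_Mapping.lookup p m) * var v"
      unfolding mon_def var_def mult_single by simp
    moreover have "Poly_Mapping.keys (m - expo v) \<subseteq> V"
      using mV by (auto simp: in_keys_iff lookup_minus subset_iff)
    ultimately show ?thesis using is_idealD(4)[OF P v(2)] single_polys_on by metis
  qed
  then have "(\<Sum>m\<in>Poly_Mapping.keys p - K. mon m) \<in> P" by (rule is_ideal_sum[OF P])
  moreover have "p = (\<Sum>m\<in>Poly_Mapping.keys p - K. mon m) + (\<Sum>m\<in>K. mon m)"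
    unfolding mon_def
    by (subst (1) poly_mapping_sum_single, rule sum.subset_diff) (auto simp: K_def)
  moreover have "(\<Sum>m\<in>K. mon m) \<in> polys_on W"
    unfolding mon_def by (intro polys_on_sum single_polys_on) (auto simp: K_def)
  ultimately show thesis using that[of "\<Sum>m\<in>K. mon m"] by (metis add_diff_cancel_right')
qed

text \<open>Witnesses of the strict inclusions are reduced modulo \<open>P 0\<close> to the
  variables outside it; no membership changes, because \<open>P 0\<close> lies in every
  \<open>P i\<close>. With more witnesses than such variables, the number \<open>d ^ m\<close> of
  products would outgrow the number of monomials available to them.\<close>

lemma prime_chain_length_le:
  fixes P :: "nat \<Rightarrow> ('v, 'k::field) mpoly set"
  assumes V: "finite V" and prime: "\<And>i. i \<le> m \<Longrightarrow> prime_ideal V (P i)"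
    and strict: "\<And>i. i < m \<Longrightarrow> P i \<subset> P (Suc i)"
  shows "m \<le> card {v \<in> V. var v \<notin> P 0}"
proof (rule ccontr)
  let ?W = "{v \<in> V. var v \<notin> P 0}"
  let ?n = "card ?W"
  assume "\<not> ?thesis"
  then have mn: "Suc ?n \<le> m" by simp
  have P0: "i \<le> m \<Longrightarrow> P 0 \<subseteq> P i" for i
  proof (induction i)
    case (Suc i)
    then show ?case using strict[of i] by auto
  qed simp
  have "\<exists>q. q \<in> polys_on ?W \<and> q \<in> P (Suc i) \<and> q \<notin> P i" if i: "i < m" for i
  proof -
    obtain p where p: "p \<in> P (Suc i)" "p \<notin> P i" using strict[OF i] by blast
    have I: "is_ideal V (P i)" "is_ideal V (P (Suc i))" "is_ideal V (P 0)"
      using prime_idealD(1)[OF prime] i by auto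
    have "p \<in> polys_on V" using p is_idealD(1)[OF I(2)] by blast
    then obtain q where q: "q \<in> polys_on ?W" "p - q \<in> P 0"
      using ideal_reduce[OF I(3)] by blast
    then have pq: "p - q \<in> P i" "p - q \<in> P (Suc i)" using P0[of i] P0[of "Suc i"] i by auto
    have "q \<in> P (Suc i)" using is_ideal_diff[OF I(2) p(1) pq(2)] by simp
    moreover have "q \<notin> P i" using is_idealD(3)[OF I(1) pq(1), of q] p(2) by auto
    ultimately show ?thesis using q by blast
  qed
  then have "\<forall>i\<in>{..<m}. \<exists>q. q \<in> polys_on ?W \<and> q \<in> P (Suc i) \<and> q \<notin> P i" by simp
  from bchoice[OF this] obtain f
    where f: "\<And>i. i < m \<Longrightarrow> f i \<in> polys_on ?W \<and> f i \<in> P (Suc i) \<and> f i \<notin> P i" by auto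
  then have "\<forall>i\<in>{..<m}. \<exists>N. bounded_on ?W N (f i)" using bounded_on_exists by blast
  from bchoice[OF this] obtain N where N: "\<And>i. i < m \<Longrightarrow> bounded_on ?W (N i) (f i)" by auto
  define D where "D = Max (insert 0 (N ` {..<m}))"
  have "bounded_on ?W D (f i)" if "i < m" for i
    by (rule bounded_on_mono[OF N[OF that]]) (use that in \<open>auto simp: D_def\<close>)
  then have count: "d ^ m \<le> Suc (m * (d * D)) ^ ?n" for d
    using f strict V by (intro prime_chain_count[OF prime, where f = f]) auto
  \<comment> \<open>Since \<open>Suc (m * (d * D)) \<le> d * Suc (m * D)\<close>, the count is at
    most \<open>d ^ ?n * Suc (m * D) ^ ?n\<close>. This \<open>d\<close> just exceeds the second
    factor, which pushes the bound below \<open>d ^ Suc ?n\<close>.\<close>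
  define d where "d = Suc (Suc (m * D) ^ ?n)"
  have "Suc (m * (d * D)) \<le> d * Suc (m * D)"
    by (simp add: d_def algebra_simps)
  then have "Suc (m * (d * D)) ^ ?n \<le> (d * Suc (m * D)) ^ ?n" by (rule power_mono) simp
  also have "\<dots> = d ^ ?n * Suc (m * D) ^ ?n" by (rule power_mult_distrib)
  also have "\<dots> < d ^ ?n * d" by (simp add: d_def)
  also have "\<dots> = d ^ Suc ?n" by simp
  also have "\<dots> \<le> d ^ m" using mn by (intro power_increasing) (auto simp: d_def)
  finally show False using count[of d] by simp
qed

subsection \<open>Monomial substitutions\<close>

definition edvd :: "('v \<Rightarrow>\<^sub>0 nat) \<Rightarrow> ('v \<Rightarrow>\<^sub>0 nat) \<Rightarrow> bool" where
  "edvd a m \<longleftrightarrow> (\<forall>v. Poly_Mapping.lookup a v \<le> Poly_Mapping.lookup m v)"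

lemma edvd_decompose: "edvd a m \<Longrightarrow> m = a + (m - a)"
  by (intro poly_mapping_eqI) (auto simp: edvd_def lookup_add lookup_minus)

lemma edvd_trans_add: "edvd a m \<Longrightarrow> edvd a (n + m)"
  by (auto simp: edvd_def lookup_add intro: order_trans trans_le_add2)

lemma lookup_single_mult:
  fixes p :: "('v, 'k::comm_ring_1) mpoly"
  shows "Poly_Mapping.lookup (Poly_Mapping.single a c * p) (a + m) = c * Poly_Mapping.lookup p m"
proof -
  have "Poly_Mapping.single a c * p = (\<Sum>n\<in>Poly_Mapping.keys p. Poly_Mapping.single (a + n) (c * Poly_Mapping.lookup p n))"
    by (subst (1) poly_mapping_sum_single) (simp add: sum_distrib_left mult_single)
  then show ?thesis
    by (auto simp: lookup_sum lookup_single when_def in_keys_iff)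
qed

lemma lookup_single_mult_not_edvd:
  fixes p :: "('v, 'k::comm_ring_1) mpoly"
  assumes "\<not> edvd a m"
  shows "Poly_Mapping.lookup (Poly_Mapping.single a c * p) m = 0"
proof (rule ccontr)
  assume "Poly_Mapping.lookup (Poly_Mapping.single a c * p) m \<noteq> 0"
  then have "m \<in> Poly_Mapping.keys (Poly_Mapping.single a c * p)" by (simp add: in_keys_iff)
  then obtain x b where "x \<in> Poly_Mapping.keys (Poly_Mapping.single a c)" "m = x + b"
    by (rule keys_mult_expo)
  then show False using assms by (auto simp: edvd_def lookup_add split: if_splits)
qed

text \<open>Adding one variable at a time is the form in which the congruence modulo the glued ideal
  telescopes.\<close>

lemma expo_induct [case_names zero add]:
  assumes zero: "Q 0" and add: "\<And>v m. Q m \<Longrightarrow> Q (expo v + m)"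
  shows "Q (m :: 'v \<Rightarrow>\<^sub>0 nat)"
proof (induction m rule: update_induct)
  case (update f a b)
  have "Q (Poly_Mapping.single a n + f)" for n
  proof (induction n)
    case (Suc n)
    have "Poly_Mapping.single a (Suc n) + f = expo a + (Poly_Mapping.single a n + f)"
      using single_add[of a 1 n] by (simp add: add.assoc)
    then show ?case using add[OF Suc] by simp
  qed (use update in simp)
  moreover have "Poly_Mapping.update a b f = Poly_Mapping.single a b + f"
    using update(1) by (intro poly_mapping_eqI) (auto simp: lookup_update lookup_add lookup_single when_def in_keys_iff)
  ultimately show ?case by simp
qed (rule zero)

text \<open>Summing singletons lets exponents add up when \<open>\<sigma>\<close> sends several
  variables to the same one, as gluing does.\<close>

definition ren :: "('v \<Rightarrow> 'v) \<Rightarrow> ('v \<Rightarrow>\<^sub>0 nat) \<Rightarrow> ('v \<Rightarrow>\<^sub>0 nat)" where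
  "ren \<sigma> m = (\<Sum>v\<in>Poly_Mapping.keys m. Poly_Mapping.single (\<sigma> v) (Poly_Mapping.lookup m v))"

lemma ren_0 [simp]: "ren \<sigma> 0 = 0"
  by (simp add: ren_def)

lemma ren_single [simp]: "ren \<sigma> (Poly_Mapping.single v n) = Poly_Mapping.single (\<sigma> v) n"
  by (simp add: ren_def)

lemma ren_add: "ren \<sigma> (m + n) = ren \<sigma> m + ren \<sigma> n"
  unfolding ren_def by (rule setsum_keys_plus_distrib) (simp_all add: single_add)

lemma keys_ren: "Poly_Mapping.keys (ren \<sigma> m) \<subseteq> \<sigma> ` Poly_Mapping.keys m"
  unfolding ren_def
  by (rule order_trans[OF keys_sum]) auto

definition polysubst :: "('v \<Rightarrow> 'v) \<Rightarrow> ('v, 'k::comm_ring_1) mpoly \<Rightarrow> ('v, 'k) mpoly" where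
  "polysubst \<sigma> p = (\<Sum>m\<in>Poly_Mapping.keys p. Poly_Mapping.single (ren \<sigma> m) (Poly_Mapping.lookup p m))"

lemma polysubst_0 [simp]: "polysubst \<sigma> 0 = 0"
  by (simp add: polysubst_def)

lemma polysubst_single [simp]: "polysubst \<sigma> (Poly_Mapping.single m c) = Poly_Mapping.single (ren \<sigma> m) c"
  by (simp add: polysubst_def)

lemma polysubst_1 [simp]: "polysubst \<sigma> 1 = 1"
  using polysubst_single[of \<sigma> 0 1] by simp

lemma polysubst_var [simp]: "polysubst \<sigma> (var v) = var (\<sigma> v)"
  by (simp add: var_def)

lemma polysubst_add: "polysubst \<sigma> (p + q) = polysubst \<sigma> p + polysubst \<sigma> q"
  unfolding polysubst_def by (rule setsum_keys_plus_distrib) (simp_all add: single_add)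

lemma polysubst_sum: "polysubst \<sigma> (sum f F) = (\<Sum>i\<in>F. polysubst \<sigma> (f i))"
  by (induction F rule: infinite_finite_induct) (auto simp: polysubst_add)

lemma polysubst_diff: "polysubst \<sigma> (p - q) = polysubst \<sigma> p - polysubst \<sigma> q"
  using polysubst_add[of \<sigma> "p - q" q] by simp

lemma polysubst_mult: "polysubst \<sigma> (p * q) = polysubst \<sigma> p * polysubst \<sigma> q"
proof -
  have "p * q = (\<Sum>m\<in>Poly_Mapping.keys p. \<Sum>n\<in>Poly_Mapping.keys q.
      Poly_Mapping.single (m + n) (Poly_Mapping.lookup p m * Poly_Mapping.lookup q n))"
    by (subst (1) poly_mapping_sum_single[of p], subst (1) poly_mapping_sum_single[of q])
      (simp add: sum_product mult_single)
  then show ?thesis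
    by (simp add: polysubst_sum ren_add) (simp add: polysubst_def sum_product mult_single)
qed

lemma polysubst_polys_on:
  assumes "p \<in> polys_on V" "\<sigma> ` V \<subseteq> V"
  shows "polysubst \<sigma> p \<in> polys_on V"
  unfolding polysubst_def
proof (intro polys_on_sum single_polys_on)
  fix m assume "m \<in> Poly_Mapping.keys p"
  then show "Poly_Mapping.keys (ren \<sigma> m) \<subseteq> V"
    using polys_onD[OF assms(1)] keys_ren[of \<sigma> m] assms(2) by blast
qed

subsection \<open>Cohen--Macaulay bipartite graphs\<close>

text \<open>The graph of a poset in the sense of Herzog and Hibi: the bijection \<open>\<beta>\<close> is a perfect matching
  between the two sides, and \<open>a \<le> b\<close> iff \<open>{a, \<beta> b}\<close> is an edge.\<close>

locale poset_graph =
  fixes A :: "'v set" and \<beta> :: "'v \<Rightarrow> 'v" and E :: "'v set set"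
  assumes finite_A: "finite A" and inj: "inj_on \<beta> A" and disj: "A \<inter> \<beta> ` A = {}"
    and edges: "\<And>e. e \<in> E \<Longrightarrow> \<exists>a\<in>A. \<exists>b\<in>A. e = {a, \<beta> b}"
    and refl: "\<And>a. a \<in> A \<Longrightarrow> {a, \<beta> a} \<in> E"
    and trans: "\<And>a b c. a \<in> A \<Longrightarrow> b \<in> A \<Longrightarrow> c \<in> A \<Longrightarrow> {a, \<beta> b} \<in> E \<Longrightarrow> {b, \<beta> c} \<in> E \<Longrightarrow> {a, \<beta> c} \<in> E"
    and antisym: "\<And>a b. a \<in> A \<Longrightarrow> b \<in> A \<Longrightarrow> {a, \<beta> b} \<in> E \<Longrightarrow> {b, \<beta> a} \<in> E \<Longrightarrow> a = b"
begin

definition V where "V = A \<union> \<beta> ` A"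

text \<open>Modulo the elements \<open>s - \<beta> s\<close> with \<open>s \<in> S\<close> the edge ideal becomes a monomial ideal in the
  remaining variables, whose exponents are \<open>mono_set S\<close>.\<close>

definition glue :: "'v set \<Rightarrow> 'v \<Rightarrow> 'v" where
  "glue S v = (if v \<in> \<beta> ` S then inv_into A \<beta> v else v)"

definition mono_set :: "'v set \<Rightarrow> ('v \<Rightarrow>\<^sub>0 nat) set" where
  "mono_set S = {\<mu>. \<exists>a\<in>A. \<exists>b\<in>A. {a, \<beta> b} \<in> E \<and> edvd (expo a + expo (glue S (\<beta> b))) \<mu>}"

definition glued_ideal :: "'v set \<Rightarrow> ('v, 'k::field) mpoly set" where
  "glued_ideal S = gen_ideal V (edge_ideal V E \<union> (\<lambda>a. var a - var (\<beta> a)) ` S)"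

section \<open>Gluing matched variables: membership in the glued ideal\<close>

lemma finite_V: "finite V"
  using finite_A by (simp add: V_def)

lemma glue_A: "S \<subseteq> A \<Longrightarrow> a \<in> A \<Longrightarrow> glue S a = a"
  using disj by (auto simp: glue_def)

lemma glue_\<beta>: "S \<subseteq> A \<Longrightarrow> a \<in> A \<Longrightarrow> glue S (\<beta> a) = (if a \<in> S then a else \<beta> a)"
  using inj by (auto simp: glue_def inj_on_def inv_into_f_f[OF inj])

lemma glue_V: "S \<subseteq> A \<Longrightarrow> glue S ` V \<subseteq> V"
  by (auto simp: V_def glue_A glue_\<beta>)

lemma \<beta>_neq: "a \<in> A \<Longrightarrow> b \<in> A \<Longrightarrow> \<beta> a \<noteq> b"
  using disj by auto

lemma \<beta>_eq_iff: "a \<in> A \<Longrightarrow> b \<in> A \<Longrightarrow> \<beta> a = \<beta> b \<longleftrightarrow> a = b"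
  using inj by (auto simp: inj_on_def)

lemma edge_ideal_sub: "(edge_ideal V E :: ('v, 'k::field) mpoly set) \<subseteq> polys_on V"
  unfolding edge_ideal_def
proof (rule is_idealD(1)[OF gen_ideal_is_ideal], safe)
  fix a b assume "{a, b} \<in> E"
  then have "a \<in> V" "b \<in> V" using edges[of "{a, b}"] by (auto simp: V_def doubleton_eq_iff)
  then show "var a * var b \<in> (polys_on V :: ('v, 'k) mpoly set)"
    by (intro polys_on_mult var_polys_on)
qed

lemma edge_in_edge_ideal: "{a, b} \<in> E \<Longrightarrow> var a * var b \<in> (edge_ideal V E :: ('v, 'k::field) mpoly set)"
  unfolding edge_ideal_def by (rule set_mp[OF gen_ideal_superset]) blast

lemma gens_sub:
  assumes "S \<subseteq> A"
  shows "(edge_ideal V E :: ('v, 'k::field) mpoly set) \<union> (\<lambda>a. var a - var (\<beta> a)) ` S \<subseteq> polys_on V"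
  using edge_ideal_sub assms by (auto simp: V_def intro!: polys_on_diff var_polys_on)

lemma glued_ideal_is_ideal:
  "S \<subseteq> A \<Longrightarrow> is_ideal V (glued_ideal S :: ('v, 'k::field) mpoly set)"
  unfolding glued_ideal_def by (rule gen_ideal_is_ideal[OF gens_sub])

lemma gens_in_glued_ideal:
  "edge_ideal V E \<union> (\<lambda>a. var a - var (\<beta> a)) ` S \<subseteq> (glued_ideal S :: ('v, 'k::field) mpoly set)"
  unfolding glued_ideal_def by (rule gen_ideal_superset)

text \<open>\<open>mono_set S\<close> is closed under adding exponents, because a divisor of a
  monomial divides its multiples. Being an ideal, the set bounds the glued ideal as soon as the
  generators are checked.\<close>

lemma mono_set_is_ideal:
  assumes S: "S \<subseteq> A"
  shows "is_ideal V {p :: ('v, 'k::field) mpoly. p \<in> polys_on V \<and> Poly_Mapping.keys (polysubst (glue S) p) \<subseteq> mono_set S}"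
    (is "is_ideal V ?N")
  unfolding is_ideal_def
proof (intro conjI ballI)
  show "?N \<subseteq> polys_on V" "0 \<in> ?N" by auto
  fix p assume p: "p \<in> ?N"
  { fix q assume "q \<in> ?N"
    then show "p + q \<in> ?N"
      using p keys_add[of "polysubst (glue S) p" "polysubst (glue S) q"] by (auto simp: polysubst_add polys_on_add) }
  fix r :: "('v, 'k) mpoly" assume r: "r \<in> polys_on V"
  have "m \<in> mono_set S" if m: "m \<in> Poly_Mapping.keys (polysubst (glue S) (r * p))" for m
  proof -
    obtain a b where ab: "a \<in> Poly_Mapping.keys (polysubst (glue S) r)"
      "b \<in> Poly_Mapping.keys (polysubst (glue S) p)" "m = a + b"
      using m unfolding polysubst_mult by (rule keys_mult_expo)
    then have "b \<in> mono_set S" using p by blast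
    then show ?thesis unfolding mono_set_def ab(3) using edvd_trans_add by blast
  qed
  then show "r * p \<in> ?N" using p r by (auto intro: polys_on_mult)
qed

text \<open>The substitution sends an edge generator to its edge monomial and kills each
  \<open>var a - var (\<beta> a)\<close> with \<open>a \<in> S\<close>.\<close>

lemma glued_ideal_sub_mono:
  assumes S: "S \<subseteq> A"
  shows "glued_ideal S \<subseteq> {p :: ('v, 'k::field) mpoly. p \<in> polys_on V \<and> Poly_Mapping.keys (polysubst (glue S) p) \<subseteq> mono_set S}"
    (is "_ \<subseteq> ?N")
  unfolding glued_ideal_def
proof (rule gen_ideal_least[OF mono_set_is_ideal[OF S]], intro Un_least)
  show "edge_ideal V E \<subseteq> ?N"
    unfolding edge_ideal_def
  proof (rule gen_ideal_least[OF mono_set_is_ideal[OF S]], rule subsetI)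
    fix q :: "('v, 'k) mpoly" assume "q \<in> {var a * var b | a b. {a, b} \<in> E}"
    then obtain a b where q: "q = var a * var b" "{a, b} \<in> E" by blast
    then obtain x y where xy: "x \<in> A" "y \<in> A" "{a, b} = {x, \<beta> y}" using edges by blast
    then have q': "q = var x * var (\<beta> y)" using q(1) by (auto simp: doubleton_eq_iff ac_simps)
    have "Poly_Mapping.keys (polysubst (glue S) q) \<subseteq> {expo x + expo (glue S (\<beta> y))}"
      by (simp add: q' polysubst_mult var_def mult_single ren_add glue_A[OF S xy(1)])
    moreover have "expo x + expo (glue S (\<beta> y)) \<in> mono_set S"
      unfolding mono_set_def using xy q(2) by (auto simp: edvd_def)
    moreover have "q \<in> polys_on V"
      unfolding q' using xy by (auto simp: V_def intro!: polys_on_mult var_polys_on)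
    ultimately show "q \<in> ?N" by blast
  qed
  show "(\<lambda>a. var a - var (\<beta> a)) ` S \<subseteq> ?N"
  proof (rule image_subsetI)
    fix a assume a: "a \<in> S"
    then have "glue S a = a" "glue S (\<beta> a) = a" using S glue_A[OF S, of a] glue_\<beta>[OF S, of a] by auto
    then show "var a - var (\<beta> a) \<in> ?N"
      using a gens_sub[OF S, where 'k = 'k] by (auto simp: polysubst_diff)
  qed
qed

text \<open>For variables this comes from the generators of the ideal; it passes to monomials by
  changing one variable at a time, and to polynomials by linearity.\<close>

lemma polysubst_glue_cong:
  assumes S: "S \<subseteq> A" and p: "p \<in> polys_on V"
  shows "p - polysubst (glue S) p \<in> (glued_ideal S :: ('v, 'k::field) mpoly set)"
proof -
  note J = glued_ideal_is_ideal[OF S, where 'k = 'k]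
  have var: "var v - var (glue S v) \<in> (glued_ideal S :: ('v, 'k) mpoly set)" if v: "v \<in> V" for v
  proof (cases "v \<in> \<beta> ` S")
    case True
    then obtain a where a: "a \<in> S" "v = \<beta> a" by blast
    then have "var a - var (\<beta> a) \<in> (glued_ideal S :: ('v, 'k) mpoly set)" using gens_in_glued_ideal by blast
    then have "- (var a - var (\<beta> a)) \<in> (glued_ideal S :: ('v, 'k) mpoly set)" by (rule is_ideal_uminus[OF J])
    moreover have "glue S v = a" using a S by (auto simp: glue_\<beta> subset_iff)
    ultimately show ?thesis using a by simp
  next
    case False
    then show ?thesis using is_idealD(2)[OF J] by (simp add: glue_def)
  qed
  have mono: "Poly_Mapping.keys m \<subseteq> V \<Longrightarrow>
    Poly_Mapping.single m 1 - Poly_Mapping.single (ren (glue S) m) 1 \<in> (glued_ideal S :: ('v, 'k) mpoly set)" for m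
  proof (induction m rule: expo_induct)
    case zero
    then show ?case using is_idealD(2)[OF J] by simp
  next
    case (add v m)
    have "Poly_Mapping.keys (expo v + m) = insert v (Poly_Mapping.keys m)"
      by (auto simp: in_keys_iff lookup_add lookup_single when_def split: if_splits)
    then have vm: "v \<in> V" "Poly_Mapping.keys m \<subseteq> V" using add.prems by auto
    let ?m = "Poly_Mapping.single m 1 :: ('v, 'k) mpoly"
    let ?m' = "Poly_Mapping.single (ren (glue S) m) 1 :: ('v, 'k) mpoly"
    have split: "Poly_Mapping.single (expo v + n) 1 = var v * (Poly_Mapping.single n 1 :: ('v, 'k) mpoly)" for v n
      by (simp add: var_def mult_single)
    have "Poly_Mapping.keys (ren (glue S) m) \<subseteq> V"
      using keys_ren[of "glue S" m] glue_V[OF S] vm(2) by blast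
    \<comment> \<open>Telescoping: one summand replaces the remaining monomial, the other replaces
      the variable \<open>v\<close>.\<close>
    then have "var v * (?m - ?m') + ?m' * (var v - var (glue S v)) \<in> glued_ideal S"
      using add.IH vm var by (intro is_idealD(3,4)[OF J] var_polys_on single_polys_on) auto
    moreover have "var v * (?m - ?m') + ?m' * (var v - var (glue S v)) = var v * ?m - var (glue S v) * ?m'"
      by (simp add: algebra_simps)
    ultimately show ?case unfolding ren_add ren_single split by simp
  qed
  have "p - polysubst (glue S) p = (\<Sum>m\<in>Poly_Mapping.keys p. Poly_Mapping.single 0 (Poly_Mapping.lookup p m) *
      (Poly_Mapping.single m 1 - Poly_Mapping.single (ren (glue S) m) 1))"
    by (subst (1) poly_mapping_sum_single[of p])
      (simp add: polysubst_def right_diff_distrib mult_single sum_subtractf)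
  also have "\<dots> \<in> glued_ideal S"
    using mono polys_onD[OF p] by (intro is_ideal_sum[OF J] is_idealD(4)[OF J]) auto
  finally show ?thesis .
qed

text \<open>The edge monomial dividing \<open>m\<close> is the image of a generator of the edge
  ideal, hence congruent to it modulo the glued ideal.\<close>

lemma mono_set_in_glued_ideal:
  assumes S: "S \<subseteq> A" and m: "m \<in> mono_set S" "Poly_Mapping.keys m \<subseteq> V"
  shows "Poly_Mapping.single m c \<in> (glued_ideal S :: ('v, 'k::field) mpoly set)"
proof -
  note J = glued_ideal_is_ideal[OF S, where 'k = 'k]
  obtain a b where ab: "a \<in> A" "b \<in> A" "{a, \<beta> b} \<in> E"
    "edvd (expo a + expo (glue S (\<beta> b))) m" (is "edvd ?e m")
    using m(1) by (auto simp: mono_set_def)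
  let ?p = "var a * var (\<beta> b) :: ('v, 'k) mpoly"
  have "?p \<in> glued_ideal S"
    using edge_in_edge_ideal[OF ab(3)] gens_in_glued_ideal by blast
  moreover have "?p - polysubst (glue S) ?p \<in> glued_ideal S"
    using ab by (intro polysubst_glue_cong[OF S] polys_on_mult var_polys_on) (auto simp: V_def)
  ultimately have "polysubst (glue S) ?p \<in> glued_ideal S"
    using is_ideal_diff[OF J, of ?p "?p - polysubst (glue S) ?p"] by simp
  moreover have "polysubst (glue S) ?p = Poly_Mapping.single ?e 1"
    by (simp add: polysubst_mult glue_A[OF S ab(1)] var_def mult_single ren_add)
  moreover have "Poly_Mapping.keys (m - ?e) \<subseteq> V"
    using m(2) by (auto simp: in_keys_iff lookup_minus subset_iff)
  ultimately have "Poly_Mapping.single (m - ?e) c * Poly_Mapping.single ?e 1 \<in> glued_ideal S"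
    using is_idealD(4)[OF J] single_polys_on by metis
  moreover have "m - ?e + ?e = m"
    using edvd_decompose[OF ab(4)] by (simp add: add.commute)
  ultimately show ?thesis by (simp add: mult_single)
qed

text \<open>Membership becomes a condition on the single monomials of the substituted polynomial, so
  the nonzerodivisor argument can treat one monomial at a time.\<close>

lemma glued_ideal_iff:
  assumes S: "S \<subseteq> A"
  shows "p \<in> (glued_ideal S :: ('v, 'k::field) mpoly set) \<longleftrightarrow>
    p \<in> polys_on V \<and> Poly_Mapping.keys (polysubst (glue S) p) \<subseteq> mono_set S"
proof
  assume "p \<in> glued_ideal S"
  then show "p \<in> polys_on V \<and> Poly_Mapping.keys (polysubst (glue S) p) \<subseteq> mono_set S"
    using glued_ideal_sub_mono[OF S] by blast
next
  note J = glued_ideal_is_ideal[OF S, where 'k = 'k]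
  assume p: "p \<in> polys_on V \<and> Poly_Mapping.keys (polysubst (glue S) p) \<subseteq> mono_set S"
  have "polysubst (glue S) p \<in> polys_on V" using p glue_V[OF S] polysubst_polys_on by blast
  then have "polysubst (glue S) p \<in> glued_ideal S"
    using p by (subst poly_mapping_sum_single)
      (auto intro!: is_ideal_sum[OF J] mono_set_in_glued_ideal[OF S] dest: polys_onD)
  then show "p \<in> glued_ideal S"
    using is_idealD(3)[OF J polysubst_glue_cong[OF S]] p by fastforce
qed

text \<open>No monomial outside the glued ideal is multiplied into it by both \<open>x\<close> and \<open>\<beta> x\<close>: the two
  edges responsible compose, by transitivity, to an edge dividing the monomial itself.\<close>

lemma glued_nonzerodivisor:
  fixes g :: "('v, 'k::field) mpoly"
  assumes S: "S \<subseteq> A" and x: "x \<in> A" "x \<notin> S" and g: "g \<in> polys_on V"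
    and xg: "(var x - var (\<beta> x)) * g \<in> glued_ideal S"
  shows "g \<in> glued_ideal S"
proof -
  define h where "h = polysubst (glue S) g"
  let ?y = "\<beta> x"
  have xy: "x \<noteq> ?y" using \<beta>_neq[of x x] x by auto
  have gx: "glue S x = x" "glue S ?y = ?y" using x S by (auto simp: glue_A glue_\<beta>)
  let ?f = "(var x - var ?y) * h"
  have f: "?f = var x * h - var ?y * h" by (rule left_diff_distrib)
  have keys: "Poly_Mapping.keys ?f \<subseteq> mono_set S"
    using xg unfolding glued_ideal_iff[OF S] polysubst_mult polysubst_diff polysubst_var gx h_def by blast
  \<comment> \<open>If \<open>x\<close> does not occur in \<open>m\<close>, an edge monomial
    dividing \<open>x\<close> times \<open>m\<close> but not \<open>m\<close> must use
    \<open>x\<close>. It does so as its end in \<open>A\<close>, since \<open>x \<notin> S\<close>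
    keeps every glued \<open>\<beta> b\<close> different from \<open>x\<close>.\<close>
  have edge_x: "a = x \<and> glue S (\<beta> b) \<noteq> x" if "a \<in> A" "b \<in> A" "Poly_Mapping.lookup m x = 0"
    "edvd (expo a + expo (glue S (\<beta> b))) (expo x + m)" "\<not> edvd (expo a + expo (glue S (\<beta> b))) m" for a b m
  proof -
    have "glue S (\<beta> b) \<noteq> x" using that(1,2) x S \<beta>_neq by (auto simp: glue_\<beta>)
    moreover have "a = x"
    proof (rule ccontr)
      assume "a \<noteq> x"
      then have "edvd (expo a + expo (glue S (\<beta> b))) m"
        unfolding edvd_def
        using that(4)[unfolded edvd_def] \<open>glue S (\<beta> b) \<noteq> x\<close>
        by (auto simp: lookup_add lookup_single when_def split: if_splits)
      then show False using that(5) by simp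
    qed
    ultimately show ?thesis by simp
  qed
  have "m \<in> mono_set S" if m: "m \<in> Poly_Mapping.keys h" for m
  proof (rule ccontr)
    assume notin: "m \<notin> mono_set S"
    then have nedvd: "\<not> edvd (expo a + expo (glue S (\<beta> b))) m" if "a \<in> A" "b \<in> A" "{a, \<beta> b} \<in> E" for a b
      using that by (auto simp: mono_set_def)
    have hm: "Poly_Mapping.lookup h m \<noteq> 0" using m by (simp add: in_keys_iff)
    \<comment> \<open>No edge monomial contains the square of \<open>x\<close> or of
      \<open>\<beta> x\<close>, because these two are not yet identified.\<close>
    have le1: "Poly_Mapping.lookup (expo a + expo (glue S (\<beta> b))) v \<le> 1"
      if "a \<in> A" "b \<in> A" "v = x \<or> v = ?y" for a b v
      using that x S \<beta>_neq[of x a] \<beta>_neq[of b x] by (auto simp: lookup_add lookup_single when_def glue_\<beta> \<beta>_eq_iff)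
    have not_both: "\<not> (Poly_Mapping.lookup m x > 0 \<and> Poly_Mapping.lookup m ?y > 0)"
      using nedvd[OF x(1) x(1) refl[OF x(1)]] xy
      by (auto simp: gx edvd_def lookup_add lookup_single when_def split: if_splits)
    \<comment> \<open>If \<open>\<beta> x\<close> does not divide \<open>m\<close>, nothing in
      \<open>var (\<beta> x) * h\<close> can cancel \<open>x\<close> times the term of
      \<open>h\<close> at \<open>m\<close>.\<close>
    have ex_X: "expo x + m \<in> mono_set S" if y0: "Poly_Mapping.lookup m ?y = 0"
    proof -
      have "\<not> edvd (expo ?y) (expo x + m)"
        using y0 xy by (auto simp: edvd_def lookup_add lookup_single when_def)
      then have "Poly_Mapping.lookup ?f (expo x + m) = Poly_Mapping.lookup h m"
        unfolding f lookup_minus unfolding var_def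
        by (subst lookup_single_mult, subst lookup_single_mult_not_edvd) auto
      then show ?thesis using hm keys by (auto simp: in_keys_iff subset_iff)
    qed
    have ex_Y: "expo ?y + m \<in> mono_set S" if x0: "Poly_Mapping.lookup m x = 0"
    proof -
      have "\<not> edvd (expo x) (expo ?y + m)"
        using x0 xy by (auto simp: edvd_def lookup_add lookup_single when_def)
      then have "Poly_Mapping.lookup ?f (expo ?y + m) = - Poly_Mapping.lookup h m"
        unfolding f lookup_minus unfolding var_def
        by (subst lookup_single_mult, subst lookup_single_mult_not_edvd) auto
      then show ?thesis using hm keys by (auto simp: in_keys_iff subset_iff)
    qed
    \<comment> \<open>If \<open>v\<close> already divides \<open>m\<close>, a further factor
      \<open>v\<close> helps no edge monomial to divide, as its exponent at \<open>v\<close> is at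
      most 1.\<close>
    have zero: "Poly_Mapping.lookup m v = 0" if v: "v = x \<or> v = ?y" and "expo v + m \<in> mono_set S" for v
    proof (rule ccontr)
      assume m0: "Poly_Mapping.lookup m v \<noteq> 0"
      obtain a b where ab: "a \<in> A" "b \<in> A" "{a, \<beta> b} \<in> E" "edvd (expo a + expo (glue S (\<beta> b))) (expo v + m)"
        using \<open>expo v + m \<in> mono_set S\<close> by (auto simp: mono_set_def)
      have "Poly_Mapping.lookup (expo a + expo (glue S (\<beta> b))) u \<le> Poly_Mapping.lookup m u" for u
      proof (cases "u = v")
        case True
        then show ?thesis using le1[OF ab(1,2) v] m0 by simp
      next
        case False
        then show ?thesis using ab(4)[unfolded edvd_def, rule_format, of u]
          by (simp add: lookup_add[of _ m] lookup_single_not_eq)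
      qed
      then show False using nedvd[OF ab(1-3)] by (simp add: edvd_def)
    qed
    \<comment> \<open>By \<open>not_both\<close> one of the exponents is zero; multiplying by the
      other variable then lands in \<open>mono_set S\<close> and forces the other exponent to be
      zero too.\<close>
    have m0: "Poly_Mapping.lookup m x = 0" "Poly_Mapping.lookup m ?y = 0"
      using ex_X ex_Y zero[of x] zero[of ?y] not_both by auto
    obtain a b where ab: "a \<in> A" "b \<in> A" "{a, \<beta> b} \<in> E" "edvd (expo a + expo (glue S (\<beta> b))) (expo x + m)"
      using ex_X[OF m0(2)] by (auto simp: mono_set_def)
    have a: "a = x" "glue S (\<beta> b) \<noteq> x"
      using edge_x[OF ab(1,2) m0(1) ab(4) nedvd[OF ab(1-3)]] by auto
    obtain c d where cd: "c \<in> A" "d \<in> A" "{c, \<beta> d} \<in> E" "edvd (expo c + expo (glue S (\<beta> d))) (expo ?y + m)"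
      using ex_Y[OF m0(1)] by (auto simp: mono_set_def)
    have cy: "c \<noteq> ?y" using \<beta>_neq x cd by auto
    have "glue S (\<beta> d) = ?y"
    proof (rule ccontr)
      assume "glue S (\<beta> d) \<noteq> ?y"
      then have "edvd (expo c + expo (glue S (\<beta> d))) m"
        unfolding edvd_def
        using cd(4)[unfolded edvd_def] cy
        by (auto simp: lookup_add lookup_single when_def split: if_splits)
      then show False using nedvd[OF cd(1-3)] by simp
    qed
    then have d: "d = x" using cd(2) x S \<beta>_neq[of x d] \<beta>_eq_iff[of d x] by (auto simp: glue_\<beta> split: if_splits)
    have "Poly_Mapping.lookup m (glue S (\<beta> b)) \<ge> 1"
      using ab(4)[unfolded edvd_def, rule_format, of "glue S (\<beta> b)"] a
      by (simp add: lookup_add lookup_single when_def split: if_splits)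
    moreover have "Poly_Mapping.lookup m c \<ge> 1"
      using cd(4)[unfolded edvd_def, rule_format, of c] cy
      by (simp add: lookup_add lookup_single when_def split: if_splits)
    \<comment> \<open>Equality would demand exponent 2 in \<open>m\<close>. It could only come from
      \<open>b = c\<close>, where antisymmetry forces \<open>b = x\<close>, contrary to
      \<open>x \<notin> S\<close>.\<close>
    moreover have "c \<noteq> glue S (\<beta> b)"
    proof
      assume "c = glue S (\<beta> b)"
      then have "c = b" using cd(1) ab(2) S \<beta>_neq by (auto simp: glue_\<beta> split: if_splits)
      then have "b = x" using antisym[of x b] x ab cd a d by auto
      then show False using gx(2) \<open>c = b\<close> \<open>c = glue S (\<beta> b)\<close> xy by auto
    qed
    ultimately have "edvd (expo c + expo (glue S (\<beta> b))) m"
      unfolding edvd_def by (auto simp: lookup_add lookup_single when_def)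
    moreover have "{c, \<beta> b} \<in> E" using trans[of c x b] ab cd a d by auto
    ultimately show False using nedvd[OF cd(1) ab(2)] by blast
  qed
  then show ?thesis unfolding glued_ideal_iff[OF S] using g h_def by blast
qed

section \<open>Depth and dimension of the poset graph\<close>

lemma regular_seq_glue:
  assumes xs: "set xs = A" "distinct xs"
  shows "regular_seq V (edge_ideal V E :: ('v, 'k::field) mpoly set) (map (\<lambda>a. var a - var (\<beta> a)) xs)"
proof -
  let ?fs = "map (\<lambda>a. var a - var (\<beta> a) :: ('v, 'k) mpoly) xs"
  have J: "gen_ideal V (edge_ideal V E \<union> set (take i ?fs)) = glued_ideal (set (take i xs))" for i
    by (simp add: glued_ideal_def take_map)
  have "var ` V \<subseteq> (polys_on V :: ('v, 'k) mpoly set)" by (auto intro: var_polys_on)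
  then have irr: "is_ideal V (irrelevant_ideal V :: ('v, 'k) mpoly set)"
    unfolding irrelevant_ideal_def by (rule gen_ideal_is_ideal)
  have irr_var: "var v \<in> (irrelevant_ideal V :: ('v, 'k) mpoly set)" if "v \<in> V" for v
    using that gen_ideal_superset[of "var ` V" V] unfolding irrelevant_ideal_def by blast
  have "var a - var (\<beta> a) \<in> (irrelevant_ideal V :: ('v, 'k) mpoly set)" if "a \<in> A" for a
    by (rule is_ideal_diff[OF irr]) (use that irr_var in \<open>auto simp: V_def\<close>)
  then have 1: "set ?fs \<subseteq> irrelevant_ideal V" using xs(1) by auto
  \<comment> \<open>The polynomial 1 has exponent 0, which no edge monomial divides; hence the ideal
    is proper.\<close>
  have "(0 :: 'v \<Rightarrow>\<^sub>0 nat) \<notin> mono_set A"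
  proof
    assume "0 \<in> mono_set A"
    then obtain a b where "edvd (expo a + expo (glue A (\<beta> b))) 0" by (auto simp: mono_set_def)
    then have "Poly_Mapping.lookup (expo a + expo (glue A (\<beta> b))) a \<le> 0" by (simp add: edvd_def)
    then show False by (simp add: lookup_add)
  qed
  then have "1 \<notin> (glued_ideal A :: ('v, 'k) mpoly set)"
    by (simp add: glued_ideal_iff[OF order_refl])
  then have "glued_ideal A \<noteq> (polys_on V :: ('v, 'k) mpoly set)" by auto
  then have 2: "gen_ideal V (edge_ideal V E \<union> set ?fs) \<noteq> polys_on V"
    using J[of "length xs"] xs(1) by simp
  have 3: "g \<in> gen_ideal V (edge_ideal V E \<union> set (take i ?fs))"
    if "i < length ?fs" "g \<in> polys_on V" "?fs ! i * g \<in> gen_ideal V (edge_ideal V E \<union> set (take i ?fs))" for i g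
    unfolding J
  proof (rule glued_nonzerodivisor[of _ "xs ! i"])
    show "set (take i xs) \<subseteq> A" using xs(1) set_take_subset by metis
    show "xs ! i \<in> A" using that(1) xs(1) by auto
    show "xs ! i \<notin> set (take i xs)"
      using that(1) xs(2) by (auto simp: in_set_conv_nth nth_eq_iff_index_eq)
    show "g \<in> polys_on V" by (rule that(2))
    show "(var (xs ! i) - var (\<beta> (xs ! i))) * g \<in> glued_ideal (set (take i xs))"
      using that(1,3) unfolding J by simp
  qed
  show ?thesis unfolding regular_seq_def
    by (intro conjI allI ballI impI) (fact 1, fact 2, fact 3)
qed

text \<open>The bottom prime contains an end of each matching edge \<open>{a, \<beta> a}\<close>, so
  at most one variable of each pair stays outside, and \<open>glue A\<close> sends it to the member
  of the pair in \<open>A\<close>.\<close>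

lemma prime_chain_le:
  fixes P :: "nat \<Rightarrow> ('v, 'k::field) mpoly set"
  assumes P: "\<And>i. i \<le> m \<Longrightarrow> prime_ideal V (P i) \<and> edge_ideal V E \<subseteq> P i"
    and strict: "\<And>i. i < m \<Longrightarrow> P i \<subset> P (Suc i)"
  shows "m \<le> card A"
proof -
  let ?W = "{v \<in> V. var v \<notin> P 0}"
  have "m \<le> card ?W"
    by (rule prime_chain_length_le[OF finite_V]) (use P strict in auto)
  also have "\<dots> \<le> card A"
  proof (rule card_inj_on_le[OF _ _ finite_A])
    have "\<not> (a \<in> ?W \<and> \<beta> a \<in> ?W)" if "a \<in> A" for a
    proof -
      have "var a * var (\<beta> a) \<in> P 0" using edge_in_edge_ideal[OF refl[OF that]] P[of 0] by blast
      moreover have "var a \<in> (polys_on V :: ('v, 'k) mpoly set)" "var (\<beta> a) \<in> (polys_on V :: ('v, 'k) mpoly set)"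
        using that by (auto simp: V_def intro!: var_polys_on)
      ultimately show ?thesis
        using prime_idealD(3)[of V "P 0" "var a" "var (\<beta> a)"] P[of 0] by simp
    qed
    moreover have "u = v \<or> u \<in> A \<and> v = \<beta> u \<or> v \<in> A \<and> u = \<beta> v"
      if "u \<in> V" "v \<in> V" "glue A u = glue A v" for u v
      using that by (auto simp: V_def glue_A glue_\<beta>)
    ultimately show "inj_on (glue A) ?W"
      unfolding inj_on_def by blast
    show "glue A ` ?W \<subseteq> A" by (auto simp: V_def glue_A glue_\<beta>)
  qed
  finally show ?thesis .
qed

text \<open>Both suprema are attained maxima, so the default value of \<open>Sup\<close> on
  unbounded sets of naturals never enters. One regular sequence gives both lower bounds, and one
  bound on prime chains gives both upper bounds.\<close>

theorem cohen_macaulay_edge_ideal: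
  "cohen_macaulay V (edge_ideal V E :: ('v, 'k::field) mpoly set)"
proof -
  let ?I = "edge_ideal V E :: ('v, 'k) mpoly set"
  obtain xs where xs: "set xs = A" "distinct xs" using finite_distinct_list[OF finite_A] by blast
  let ?C = "\<lambda>n. \<exists>P :: nat \<Rightarrow> ('v, 'k) mpoly set.
       (\<forall>i\<le>n. prime_ideal V (P i) \<and> ?I \<subseteq> P i) \<and> (\<forall>i<n. P i \<subset> P (Suc i))"
  have le: "n \<le> card A" if "?C n" for n
    using that prime_chain_le by blast
  have reg: "regular_seq V ?I (map (\<lambda>a. var a - var (\<beta> a)) xs)" by (rule regular_seq_glue[OF xs])
  have len: "length (map (\<lambda>a. var a - var (\<beta> a) :: ('v, 'k) mpoly) xs) = card A"
    using xs distinct_card by fastforce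
  have chain: "?C (length fs)" if "regular_seq V ?I fs" for fs
    by (rule regular_seq_prime_chain[OF edge_ideal_sub that])
  have "depth V ?I = card A"
    unfolding depth_def
  proof (rule cSup_eq_maximum)
    show "card A \<in> {length fs | fs. regular_seq V ?I fs}" using reg len by force
    show "x \<le> card A" if "x \<in> {length fs | fs. regular_seq V ?I fs}" for x
      using that chain le by blast
  qed
  moreover have "krull_dim V ?I = card A"
    unfolding krull_dim_def
  proof (rule cSup_eq_maximum)
    show "card A \<in> {n. ?C n}" using chain[OF reg] len by simp
    show "x \<le> card A" if "x \<in> {n. ?C n}" for x using that le by blast
  qed
  ultimately show ?thesis by (simp add: cohen_macaulay_def)
qed

end

subsection \<open>Linear presentation connects minimal covers\<close>

text \<open>The restriction to \<open>U\<close>, later \<open>C1 \<union> C2\<close>, reflects that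
  only monomials dividing the lcm of the two cover monomials matter.\<close>

definition swap_rel :: "'v set \<Rightarrow> 'v set set \<Rightarrow> 'v set \<Rightarrow> ('v set \<times> 'v set) set" where
  "swap_rel V E U = {(D, D'). min_vertex_cover V E D \<and> min_vertex_cover V E D' \<and> D \<subseteq> U \<and> D' \<subseteq> U
      \<and> (\<exists>v w. D' = insert w (D - {v}))}"

definition chi :: "'v set \<Rightarrow> 'v \<Rightarrow>\<^sub>0 nat" where
  "chi D = (\<Sum>t\<in>D. expo t)"

lemma lookup_chi: "finite D \<Longrightarrow> Poly_Mapping.lookup (chi D) v = (if v \<in> D then 1 else 0)"
  by (simp add: chi_def lookup_sum lookup_single when_def sum.delta)

lemma prod_var_eq: "(\<Prod>t\<in>D. var t :: ('v, 'k::comm_ring_1) mpoly) = Poly_Mapping.single (chi D) 1"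
  by (induction D rule: infinite_finite_induct) (auto simp: chi_def var_def mult_single)

lemma prod_var_inj:
  assumes "finite C" "finite D" "(\<Prod>t\<in>C. var t :: ('v, 'k::comm_ring_1) mpoly) = (\<Prod>t\<in>D. var t)"
  shows "C = D"
proof -
  have "Poly_Mapping.keys (Poly_Mapping.single (chi C) (1 :: 'k)) = Poly_Mapping.keys (Poly_Mapping.single (chi D) (1 :: 'k))"
    using assms(3) by (simp add: prod_var_eq)
  then have "chi C = chi D" by simp
  then have "(if v \<in> C then 1 else 0) = (if v \<in> D then 1 else (0::nat))" for v
    unfolding lookup_chi[OF assms(1), symmetric] lookup_chi[OF assms(2), symmetric] by (rule arg_cong)
  then have "v \<in> C \<longleftrightarrow> v \<in> D" for v by (metis zero_neq_one)
  then show ?thesis by (rule set_eqI)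
qed

lemma chi_union: "finite C \<Longrightarrow> finite D \<Longrightarrow> chi (D - C) + chi C = chi (C \<union> D)"
  by (intro poly_mapping_eqI) (simp add: lookup_add lookup_chi)

lemma mdeg_1:
  assumes "mdeg m = 1"
  obtains v where "m = expo v"
proof -
  obtain v where v: "v \<in> Poly_Mapping.keys m" "Poly_Mapping.lookup m v = 1"
    "\<forall>w\<in>Poly_Mapping.keys m. v \<noteq> w \<longrightarrow> Poly_Mapping.lookup m w = 0"
    using assms unfolding mdeg_def by (auto simp: sum_eq_Suc0_iff)
  then have "m = expo v"
    by (intro poly_mapping_eqI) (auto simp: lookup_single when_def in_keys_iff)
  then show thesis by (rule that)
qed

text \<open>Grade the syzygies by monomials. In degree \<open>chi (C1 \<union> C2)\<close>, restricting a linear syzygy to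
  one connected component of the swap graph again yields a syzygy, because two covers that contribute
  to the same monomial are swaps of each other; the syzygy between C1 and C2 violates this
  if C2 is in another component.\<close>

lemma linearly_presented_swap_path:
  fixes V :: "'v set"
  assumes V: "finite V" and lp: "linearly_presented V (cover_gens V E :: ('v, 'k::field) mpoly set)"
    and C: "min_vertex_cover V E C1" "min_vertex_cover V E C2"
  shows "(C1, C2) \<in> (swap_rel V E (C1 \<union> C2))\<^sup>*"
proof (cases "C1 = C2")
  case False
  define u :: "'v set \<Rightarrow> ('v, 'k) mpoly" where "u D = (\<Prod>t\<in>D. var t)" for D
  define CC where "CC = {C. min_vertex_cover V E C}"
  define K where "K = {D. (C1, D) \<in> (swap_rel V E (C1 \<union> C2))\<^sup>*}"
  let ?m = "chi (C1 \<union> C2)"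
  have subV: "D \<subseteq> V" if "D \<in> CC" for D
    using that by (simp add: CC_def min_vertex_cover_def vertex_cover_def)
  have fin: "finite D" if "D \<in> CC" for D using subV[OF that] V by (rule finite_subset)
  have finCC: "finite CC" using subV V by (auto intro: finite_subset[of _ "Pow V"])
  have C12: "C1 \<in> CC" "C2 \<in> CC" using C by (auto simp: CC_def)
  have K_CC: "K \<subseteq> CC"
  proof
    fix D assume "D \<in> K"
    then have "(C1, D) \<in> (swap_rel V E (C1 \<union> C2))\<^sup>*" by (simp add: K_def)
    then show "D \<in> CC" by (cases rule: rtranclE) (use C12 in \<open>auto simp: swap_rel_def CC_def\<close>)
  qed
  have C1K: "C1 \<in> K" by (simp add: K_def)
  have inj: "inj_on u CC"
    by (rule inj_onI) (use fin prod_var_inj[where 'k = 'k] in \<open>auto simp: u_def\<close>)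
  have U: "cover_gens V E = u ` CC" by (simp add: cover_gens_def u_def CC_def)
  have sum_U: "(\<Sum>x\<in>cover_gens V E. h x * x) = (\<Sum>D\<in>CC. h (u D) * u D)" for h
    unfolding U by (rule sum.reindex_cong[OF inj]) auto
  \<comment> \<open>The contribution of the component of \<open>C1\<close> to the syzygy sum. It is
    linear in \<open>h\<close> over the polynomial ring, so it can be evaluated on the linear
    syzygies that generate.\<close>
  define G where "G h = (\<Sum>D\<in>K. h (u D) * u D)" for h :: "('v, 'k) mpoly \<Rightarrow> ('v, 'k) mpoly"
  have G_linear: "Poly_Mapping.lookup (G g) b = 0"
    if g: "g \<in> syz V (cover_gens V E)" "\<And>x. x \<in> cover_gens V E \<Longrightarrow> homog 1 (g x)" and b: "edvd b ?m" for g b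
  proof (cases "\<forall>D\<in>K. Poly_Mapping.lookup (g (u D) * u D) b = 0")
    case True
    then show ?thesis by (simp add: G_def lookup_sum)
  next
    case False
    \<comment> \<open>A linear entry contributes a variable times the monomial of \<open>D\<close>;
      as \<open>b\<close> divides the lcm monomial, \<open>D\<close> stays inside
      \<open>C1 \<union> C2\<close>.\<close>
    have dec: "\<exists>v. b = expo v + chi D \<and> D \<subseteq> C1 \<union> C2"
      if D: "D \<in> CC" "Poly_Mapping.lookup (g (u D) * u D) b \<noteq> 0" for D
    proof -
      have "b \<in> Poly_Mapping.keys (g (u D) * u D)" using D(2) by (simp add: in_keys_iff)
      then obtain a c where ac: "a \<in> Poly_Mapping.keys (g (u D))" "c \<in> Poly_Mapping.keys (u D)" "b = a + c"
        by (rule keys_mult_expo)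
      have c: "c = chi D" using ac(2) by (simp add: u_def prod_var_eq)
      have "homog 1 (g (u D))" using g(2) D(1) by (simp add: U)
      then have "mdeg a = 1" using ac(1) by (simp add: homog_def)
      then obtain v where "a = expo v" by (rule mdeg_1)
      moreover have "t \<in> C1 \<union> C2" if "t \<in> D" for t
        using b[unfolded edvd_def, rule_format, of t] that fin[OF D(1)] fin[OF C12(1)] fin[OF C12(2)]
        by (simp add: ac(3) c lookup_add lookup_chi split: if_splits)
      ultimately show ?thesis using ac(3) c by blast
    qed
    obtain D where D: "D \<in> K" "Poly_Mapping.lookup (g (u D) * u D) b \<noteq> 0" using False by blast
    have inK: "D' \<in> K" if D': "D' \<in> CC" "Poly_Mapping.lookup (g (u D') * u D') b \<noteq> 0" for D'
    proof -
      have DC: "D \<in> CC" using D K_CC by blast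
      obtain v where v: "b = expo v + chi D" "D \<subseteq> C1 \<union> C2" using dec[OF DC D(2)] by blast
      obtain w where w: "b = expo w + chi D'" "D' \<subseteq> C1 \<union> C2" using dec[OF D'] by blast
      \<comment> \<open>Exponents of the two factorizations of \<open>b\<close> are compared vertex
        by vertex: the covers agree or differ by one exchange.\<close>
      have eq: "(if v = t then 1 else 0) + (if t \<in> D then 1 else 0) = (if w = t then 1 else 0) + (if t \<in> D' then 1 else (0::nat))" for t
        using arg_cong[OF trans[OF v(1)[symmetric] w(1)], of "\<lambda>b. Poly_Mapping.lookup b t"]
        by (simp add: lookup_add lookup_single when_def lookup_chi[OF fin] DC D'(1) split: if_splits)
      show ?thesis
      proof (cases "v = w")
        case True
        have "(t \<in> D) = (t \<in> D')" for t using eq[of t] True by (auto split: if_splits)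
        then have "D = D'" by blast
        then show ?thesis using D by simp
      next
        case False
        have "(t \<in> D') = (t = v \<or> t \<in> D \<and> t \<noteq> w)" for t
          using eq[of t] False by (auto split: if_splits)
        then have "D' = insert v (D - {w})" by blast
        then have "(D, D') \<in> swap_rel V E (C1 \<union> C2)"
          using DC D'(1) v(2) w(2) unfolding swap_rel_def CC_def by blast
        then show ?thesis using D(1) unfolding K_def by (auto intro: rtrancl_into_rtrancl)
      qed
    qed
    have "Poly_Mapping.lookup (G g) b = (\<Sum>D\<in>K. Poly_Mapping.lookup (g (u D) * u D) b)"
      by (simp add: G_def lookup_sum)
    also have "\<dots> = (\<Sum>D\<in>CC. Poly_Mapping.lookup (g (u D) * u D) b)"
      by (rule sum.mono_neutral_left[OF finCC K_CC]) (use inK in blast)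
    also have "\<dots> = Poly_Mapping.lookup (\<Sum>x\<in>cover_gens V E. g x * x) b"
      by (simp add: sum_U lookup_sum)
    also have "\<dots> = 0" using g(1) by (simp add: syz_def)
    finally show ?thesis .
  qed
  \<comment> \<open>The pair syzygy of the two generators: each entry is the cofactor of its
    generator in their lcm, with opposite signs.\<close>
  define f :: "('v, 'k) mpoly \<Rightarrow> ('v, 'k) mpoly" where "f x = (if x = u C1 then Poly_Mapping.single (chi (C2 - C1)) 1
      else if x = u C2 then - Poly_Mapping.single (chi (C1 - C2)) 1 else 0)" for x
  have u_neq: "u C1 \<noteq> u C2" using inj_onD[OF inj _ C12] False by blast
  have fC1: "f (u C1) * u C1 = Poly_Mapping.single ?m 1"
    using chi_union[OF fin[OF C12(1)] fin[OF C12(2)]]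
    by (simp add: f_def u_def prod_var_eq mult_single)
  have fC2: "f (u C2) * u C2 = - Poly_Mapping.single ?m 1"
    using chi_union[OF fin[OF C12(2)] fin[OF C12(1)]] u_neq
    by (simp add: f_def u_def prod_var_eq mult_single Un_commute)
  have f_else: "f (u D) * u D = 0" if "D \<in> CC" "D \<noteq> C1" "D \<noteq> C2" for D
    using inj_onD[OF inj _ that(1) C12(1)] inj_onD[OF inj _ that(1) C12(2)] that by (auto simp: f_def)
  have "f \<in> syz V (cover_gens V E)"
  proof -
    have keys: "Poly_Mapping.keys (chi D) \<subseteq> V" if "D \<subseteq> V" for D
      using lookup_chi[OF finite_subset[OF that V]] that by (auto simp: in_keys_iff split: if_splits)
    have "f x \<in> polys_on V" for x
      using keys[of "C2 - C1"] keys[of "C1 - C2"] subV[OF C12(1)] subV[OF C12(2)]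
      by (auto simp: f_def intro!: single_polys_on polys_on_uminus)
    moreover have "f x = 0" if "x \<notin> cover_gens V E" for x
      using that C12 by (auto simp: f_def U)
    moreover have "(\<Sum>x\<in>cover_gens V E. f x * x) = (\<Sum>D\<in>{C1, C2}. f (u D) * u D)"
      unfolding sum_U by (rule sum.mono_neutral_right[OF finCC]) (use C12 f_else in auto)
    then have "(\<Sum>x\<in>cover_gens V E. f x * x) = 0" using False fC1 fC2 by simp
    ultimately show ?thesis by (simp add: syz_def)
  qed
  with lp obtain F c Lin where F: "finite F" "F \<subseteq> Lin" "f = (\<lambda>x. \<Sum>g\<in>F. c g * g x)"
    and Lin: "Lin \<subseteq> syz V (cover_gens V E)" "\<forall>g\<in>Lin. \<forall>x\<in>cover_gens V E. homog 1 (g x)"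
    unfolding linearly_presented_def by meson
  have "G f = (\<Sum>D\<in>K. \<Sum>g\<in>F. c g * (g (u D) * u D))"
    unfolding G_def F(3) by (simp add: sum_distrib_right mult.assoc)
  also have "\<dots> = (\<Sum>g\<in>F. c g * G g)"
    unfolding G_def by (subst sum.swap) (simp add: sum_distrib_left)
  finally have Gf: "G f = (\<Sum>g\<in>F. c g * G g)" .
  \<comment> \<open>The coefficient of a product at \<open>?m\<close> uses only coefficients of
    \<open>G g\<close> at divisors of \<open>?m\<close>, and these all vanish by
    \<open>G_linear\<close>.\<close>
  have "Poly_Mapping.lookup (c g * G g) ?m = 0" if g: "g \<in> F" for g
  proof (rule ccontr)
    assume "Poly_Mapping.lookup (c g * G g) ?m \<noteq> 0"
    then have "?m \<in> Poly_Mapping.keys (c g * G g)" by (simp add: in_keys_iff)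
    then obtain a b where ab: "a \<in> Poly_Mapping.keys (c g)" "b \<in> Poly_Mapping.keys (G g)" "?m = a + b"
      by (rule keys_mult_expo)
    have "Poly_Mapping.lookup (G g) b = 0"
      by (rule G_linear) (use g F(2) Lin ab(3) in \<open>auto simp: edvd_def lookup_add\<close>)
    then show False using ab(2) by (simp add: in_keys_iff)
  qed
  then have zero: "Poly_Mapping.lookup (G f) ?m = 0" by (simp add: Gf lookup_sum)
  have "C2 \<in> K"
  proof (rule ccontr)
    assume "C2 \<notin> K"
    \<comment> \<open>With \<open>C2\<close> outside the component, nothing cancels the term of
      \<open>C1\<close>, and the coefficient at \<open>?m\<close> is 1.\<close>
    then have "G f = (\<Sum>D\<in>{C1}. f (u D) * u D)"
      unfolding G_def
      by (intro sum.mono_neutral_right) (use finite_subset[OF K_CC finCC] C1K K_CC f_else in auto)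
    then show False using zero fC1 by simp
  qed
  then show ?thesis by (simp add: K_def)
qed simp

subsection \<open>From swaps to a poset\<close>

lemma vertex_coverD:
  assumes "vertex_cover V E C"
  shows "C \<subseteq> V" "e \<in> E \<Longrightarrow> e \<inter> C \<noteq> {}"
  using assms unfolding vertex_cover_def by auto

lemma min_vertex_cover_below:
  assumes "finite D" "vertex_cover V E D"
  obtains C where "min_vertex_cover V E C" "C \<subseteq> D"
proof -
  have "finite {C. C \<subseteq> D \<and> vertex_cover V E C}" using assms(1) by simp
  from finite_has_minimal2[OF this, of D] obtain C
    where C: "C \<subseteq> D" "vertex_cover V E C" "\<And>C'. C' \<subseteq> D \<Longrightarrow> vertex_cover V E C' \<Longrightarrow> C' \<subseteq> C \<Longrightarrow> C = C'"
    using assms(2) by auto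
  have "\<not> vertex_cover V E C'" if "C' \<subset> C" for C'
    using C(3)[of C'] C(1) that by auto
  then have "min_vertex_cover V E C"
    unfolding min_vertex_cover_def using C(2) by simp
  then show thesis using C(1) by (rule that)
qed

text \<open>\<open>A\<close> and \<open>B\<close> stand for \<open>C1 - C2\<close> and
  \<open>C2 - C1\<close>, and \<open>E\<close> for the edges of \<open>G[L]\<close>. That
  \<open>A\<close> is a minimal cover fixes the common size of all minimal covers at
  \<open>card A\<close>.\<close>

locale swap_graph =
  fixes A B :: "'v set" and E :: "'v set set"
  assumes finite_A: "finite A" and finite_B: "finite B" and disj: "A \<inter> B = {}"
    and edges: "\<And>e. e \<in> E \<Longrightarrow> \<exists>a\<in>A. \<exists>b\<in>B. e = {a, b}"
    and min_A: "min_vertex_cover (A \<union> B) E A" and unmixed: "unmixed (A \<union> B) E"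
begin

lemma card_min_cover: "min_vertex_cover (A \<union> B) E C \<Longrightarrow> card C = card A"
  using min_A unmixed unfolding unmixed_def by blast

lemma card_cover:
  assumes "vertex_cover (A \<union> B) E D"
  shows "card A \<le> card D"
proof -
  have "finite D" using assms finite_A finite_B by (auto simp: vertex_cover_def intro: finite_subset)
  then obtain C where "min_vertex_cover (A \<union> B) E C" "C \<subseteq> D"
    using assms by (rule min_vertex_cover_below)
  then show ?thesis using card_min_cover[of C] card_mono[OF \<open>finite D\<close>, of C] by simp
qed

text \<open>For \<open>X \<subseteq> A\<close> and \<open>Y \<subseteq> B\<close> this says that
  \<open>(A - X) \<union> Y\<close> is a cover. In this form stability under componentwise union and
  intersection, the join and meet of covers, is immediate.\<close>

definition closed :: "'v set \<Rightarrow> 'v set \<Rightarrow> bool" where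
  "closed X Y \<longleftrightarrow> X \<subseteq> A \<and> Y \<subseteq> B \<and> (\<forall>x\<in>X. \<forall>b. {x, b} \<in> E \<longrightarrow> b \<in> Y)"

lemma edge_ends: "{a, b} \<in> E \<Longrightarrow> a \<in> A \<Longrightarrow> b \<in> B"
  using edges[of "{a, b}"] disj by (auto simp: doubleton_eq_iff)

lemma closed_card:
  assumes "closed X Y"
  shows "card X \<le> card Y"
proof -
  have XY: "X \<subseteq> A" "Y \<subseteq> B" using assms by (auto simp: closed_def)
  have fin: "finite X" "finite Y" using XY finite_A finite_B finite_subset by blast+
  have "vertex_cover (A \<union> B) E ((A - X) \<union> Y)"
    unfolding vertex_cover_def
  proof (intro conjI ballI)
    show "A - X \<union> Y \<subseteq> A \<union> B" using XY by blast
    fix e assume e: "e \<in> E"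
    then obtain a b where "a \<in> A" "b \<in> B" "e = {a, b}" using edges by blast
    then show "e \<inter> (A - X \<union> Y) \<noteq> {}" using e assms by (auto simp: closed_def)
  qed
  then have "card A \<le> card ((A - X) \<union> Y)" by (rule card_cover)
  also have "\<dots> \<le> card (A - X) + card Y" by (rule card_Un_le)
  also have "card (A - X) = card A - card X" using XY(1) fin by (simp add: card_Diff_subset)
  finally show ?thesis using card_mono[OF finite_A XY(1)] by linarith
qed

text \<open>Inclusions replace the equation of \<open>swap_rel\<close> because an exchanged vertex
  may fall outside \<open>L\<close> when covers are intersected with it.\<close>

definition near :: "('v set \<times> 'v set) set" where
  "near = {(D, D'). vertex_cover (A \<union> B) E D' \<and> card D' = card A \<and>
      (\<exists>v w. D - {v} \<subseteq> D' \<and> D' \<subseteq> insert w D)}"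

text \<open>X and Y collect the vertices of A left and of B entered so far. Minimum covers are closed under
  joins and meets, so X and Y grow by at most one vertex each, and simultaneously; the two new
  vertices are matched.\<close>

definition matched :: "'v set \<Rightarrow> 'v set \<Rightarrow> ('v \<Rightarrow> 'v) \<Rightarrow> bool" where
  "matched X Y \<beta> \<longleftrightarrow> closed X Y \<and> bij_betw \<beta> X Y \<and> (\<forall>x\<in>X. {x, \<beta> x} \<in> E)
    \<and> (\<forall>x\<in>X. \<forall>y\<in>X. {x, \<beta> y} \<in> E \<longrightarrow> {y, \<beta> x} \<in> E \<longrightarrow> x = y)"

lemma matched_step:
  assumes m: "matched X Y \<beta>" and X: "A - D \<subseteq> X" and Y: "B \<inter> D \<subseteq> Y" and step: "(D, D') \<in> near"
  shows "\<exists>X' Y' \<beta>'. matched X' Y' \<beta>' \<and> A - D' \<subseteq> X' \<and> B \<inter> D' \<subseteq> Y'"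
proof -
  have cl: "closed X Y" and bij: "bij_betw \<beta> X Y" using m by (auto simp: matched_def)
  have XA: "X \<subseteq> A" "Y \<subseteq> B" using cl by (auto simp: closed_def)
  have finX: "finite X" "finite Y" using XA finite_A finite_B finite_subset by blast+
  obtain v w where D': "vertex_cover (A \<union> B) E D'" "card D' = card A" "D - {v} \<subseteq> D'" "D' \<subseteq> insert w D"
    using step by (auto simp: near_def)
  have D'sub: "D' \<subseteq> A \<union> B" using D'(1) by (simp add: vertex_cover_def)
  have cov: "b \<in> D'" if "{a, b} \<in> E" "a \<notin> D'" for a b
  proof -
    have "{a, b} \<inter> D' \<noteq> {}" by (rule vertex_coverD(2)[OF D'(1) that(1)])
    then show ?thesis using that(2) by auto
  qed
  define X' where "X' = X \<union> (A - D')"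
  define Y' where "Y' = Y \<union> (B \<inter> D')"
  have clD': "closed (A - D') (B \<inter> D')"
    using cov edge_ends by (auto simp: closed_def)
  have cl': "closed X' Y'" using cl clD' unfolding X'_def Y'_def closed_def by blast
  have cl'': "closed (X \<inter> (A - D')) (Y \<inter> (B \<inter> D'))" using cl clD' unfolding closed_def by blast
  have "card (A - D') = card (B \<inter> D')"
  proof -
    have "D' = (A \<inter> D') \<union> (B \<inter> D')" using D'sub by blast
    then have "card D' = card (A \<inter> D') + card (B \<inter> D')"
      using card_Un_disjoint[of "A \<inter> D'" "B \<inter> D'"] finite_A finite_B disj by auto
    moreover have "card (A - D') = card A - card (A \<inter> D')"
      using finite_A by (simp add: card_Diff_subset_Int)
    ultimately show ?thesis using D'(2) by simp
  qed
  moreover have "card X' + card (X \<inter> (A - D')) = card X + card (A - D')"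
    unfolding X'_def using card_Un_Int[of X "A - D'"] finX finite_A by simp
  moreover have "card Y' + card (Y \<inter> (B \<inter> D')) = card Y + card (B \<inter> D')"
    unfolding Y'_def using card_Un_Int[of Y "B \<inter> D'"] finX finite_B by simp
  moreover have "card X = card Y" using bij by (rule bij_betw_same_card)
  \<comment> \<open>Join and meet each have at least as many vertices on the side of
    \<open>B\<close> as on that of \<open>A\<close>, while the sums over both agree; so both
    inequalities are equalities.\<close>
  ultimately have card': "card X' = card Y'" using closed_card[OF cl'] closed_card[OF cl''] by linarith
  have X'sub: "X' \<subseteq> insert v X" using X D'(3) by (auto simp: X'_def)
  have Y'sub: "Y' \<subseteq> insert w Y" using Y D'(4) by (auto simp: Y'_def)
  have fin': "finite X'" "finite Y'" using X'sub Y'sub finX finite_subset by blast+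
  have sub': "X \<subseteq> X'" "Y \<subseteq> Y'" by (auto simp: X'_def Y'_def)
  have incl: "A - D' \<subseteq> X'" "B \<inter> D' \<subseteq> Y'" by (auto simp: X'_def Y'_def)
  show ?thesis
  proof (cases "X' = X")
    case True
    then have "Y' = Y"
      using card' \<open>card X = card Y\<close> card_subset_eq[OF fin'(2) sub'(2)] by simp
    then show ?thesis using True m incl by blast
  next
    case False
    then have v: "X' = insert v X" "v \<notin> X" using X'sub sub' by auto
    then have "card Y' = Suc (card Y)" using card' \<open>card X = card Y\<close> finX by simp
    then have "Y' \<noteq> Y" by auto
    then have w: "Y' = insert w Y" "w \<notin> Y" using Y'sub sub'(2) by auto
    \<comment> \<open>Without this edge \<open>v\<close> could join \<open>X\<close> with no new
      neighbour, giving a closed pair with more vertices in \<open>A\<close> than in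
      \<open>B\<close>.\<close>
    have vw: "{v, w} \<in> E"
    proof (rule ccontr)
      assume "{v, w} \<notin> E"
      then have "closed (insert v X) Y" using cl' cl unfolding v w closed_def by blast
      then show False using closed_card[of "insert v X" Y] v finX \<open>card X = card Y\<close> by simp
    qed
    define \<beta>' where "\<beta>' = \<beta>(v := w)"
    have \<beta>': "\<beta>' v = w" "\<And>x. x \<in> X \<Longrightarrow> \<beta>' x = \<beta> x" using v by (auto simp: \<beta>'_def)
    have "bij_betw \<beta>' X Y" using bij \<beta>'(2) by (simp cong: bij_betw_cong)
    then have "bij_betw \<beta>' X' Y'"
      using notIn_Un_bij_betw[of v X \<beta>' Y] v w \<beta>' by simp
    \<comment> \<open>Antisymmetry for the new pair: all neighbours of older vertices already lie in
      \<open>Y\<close>, and \<open>w\<close> does not.\<close>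
    moreover have "{x, w} \<notin> E" if "x \<in> X" for x using cl that w(2) by (auto simp: closed_def)
    ultimately have "matched X' Y' \<beta>'"
      using m cl' vw \<beta>' unfolding matched_def v(1) w(1) by auto
    then show ?thesis using incl by blast
  qed
qed

lemma swap_path_matched:
  assumes "(A, B) \<in> near\<^sup>*"
  obtains \<beta> where "matched A B \<beta>"
proof -
  have "\<exists>X Y \<beta>. matched X Y \<beta> \<and> A - D \<subseteq> X \<and> B \<inter> D \<subseteq> Y" if "(A, D) \<in> near\<^sup>*" for D
    using that
  proof (induction rule: rtrancl_induct)
    case base
    have "matched {} {} (\<lambda>x. x)" by (simp add: matched_def closed_def bij_betw_def)
    then show ?case using disj by blast
  next
    case (step D D')
    then show ?case using matched_step by blast
  qed
  from this[OF assms] obtain X Y \<beta> where *: "matched X Y \<beta>" "A - B \<subseteq> X" "B \<inter> B \<subseteq> Y" by blast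
  \<comment> \<open>At the end of the path every vertex of \<open>A\<close> has left and every
    vertex of \<open>B\<close> has entered.\<close>
  then have "X = A" "Y = B" using disj by (auto simp: matched_def closed_def)
  then show thesis using that *(1) by simp
qed

text \<open>If \<open>{a, \<beta> c}\<close> were no edge, some minimal cover would avoid both of
  its ends and hence contain \<open>\<beta> b\<close> and \<open>b\<close> to meet the two given
  edges. But it has \<open>card A\<close> elements and meets each of the \<open>card A\<close>
  disjoint matching edges, so it contains exactly one end of each.\<close>

lemma matched_trans:
  assumes m: "matched A B \<beta>" and abc: "a \<in> A" "b \<in> A" "c \<in> A" "{a, \<beta> b} \<in> E" "{b, \<beta> c} \<in> E"
  shows "{a, \<beta> c} \<in> E"
proof (rule ccontr)
  assume notE: "{a, \<beta> c} \<notin> E"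
  have bij: "bij_betw \<beta> A B" and edge: "\<And>x. x \<in> A \<Longrightarrow> {x, \<beta> x} \<in> E"
    using m by (auto simp: matched_def)
  let ?D = "(A \<union> B) - {a, \<beta> c}"
  have "vertex_cover (A \<union> B) E ?D"
    unfolding vertex_cover_def
  proof (intro conjI ballI)
    fix e assume e: "e \<in> E"
    then obtain x y where xy: "x \<in> A" "y \<in> B" "e = {x, y}" using edges by blast
    have "\<beta> c \<in> B" using bij abc(3) by (auto simp: bij_betw_def)
    then show "e \<inter> ?D \<noteq> {}" using xy e notE abc(1) disj by auto
  qed auto
  moreover have "finite ?D" using finite_A finite_B by simp
  ultimately obtain C where C: "min_vertex_cover (A \<union> B) E C" "C \<subseteq> ?D"
    using min_vertex_cover_below[of ?D "A \<union> B" E] by blast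
  have cov: "e \<inter> C \<noteq> {}" if "e \<in> E" for e
    using C(1) that by (auto simp: min_vertex_cover_def vertex_cover_def)
  have bC: "b \<in> C" "\<beta> b \<in> C" using cov[OF abc(4)] cov[OF abc(5)] C(2) by auto
  have finC: "finite C" using C(2) finite_A finite_B finite_subset by blast
  \<comment> \<open>The matching edges covered from the side of \<open>B\<close>. The edge of
    \<open>b\<close> is covered from both sides, which pushes the count above
    \<open>card A\<close>.\<close>
  define Z where "Z = {x \<in> A. \<beta> x \<in> C}"
  have "A \<subseteq> (C \<inter> A) \<union> Z" using cov[OF edge] by (auto simp: Z_def)
  then have "card A \<le> card ((C \<inter> A) \<union> Z)" using finite_A by (intro card_mono) (auto simp: Z_def)
  moreover have "card ((C \<inter> A) \<union> Z) + card ((C \<inter> A) \<inter> Z) = card (C \<inter> A) + card Z"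
    using card_Un_Int[of "C \<inter> A" Z] finite_A by (simp add: Z_def)
  moreover have "b \<in> (C \<inter> A) \<inter> Z" using bC abc(2) by (simp add: Z_def)
  then have "card ((C \<inter> A) \<inter> Z) \<ge> 1"
    using finite_A by (metis One_nat_def Suc_leI card_gt_0_iff empty_iff finite_Int)
  moreover have "card Z \<le> card (C \<inter> B)"
  proof (rule card_inj_on_le)
    show "inj_on \<beta> Z" using bij by (auto simp: bij_betw_def Z_def intro: inj_on_subset)
    show "\<beta> ` Z \<subseteq> C \<inter> B" using bij by (auto simp: bij_betw_def Z_def)
  qed (use finC in simp)
  moreover have "card (C \<inter> A) + card (C \<inter> B) = card C"
  proof -
    have "C = (C \<inter> A) \<union> (C \<inter> B)" using C(2) by auto
    moreover have "(C \<inter> A) \<inter> (C \<inter> B) = {}" using disj by auto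
    ultimately show ?thesis
      using card_Un_disjoint[of "C \<inter> A" "C \<inter> B"] finC by simp
  qed
  moreover have "card C = card A" by (rule card_min_cover[OF C(1)])
  ultimately show False by linarith
qed

lemma swap_path_poset_graph:
  assumes "(A, B) \<in> near\<^sup>*"
  obtains \<beta> where "poset_graph A \<beta> E" "\<beta> ` A = B"
proof -
  obtain \<beta> where m: "matched A B \<beta>" using swap_path_matched[OF assms] .
  then have bij: "bij_betw \<beta> A B" by (simp add: matched_def)
  then have img: "\<beta> ` A = B" and inj: "inj_on \<beta> A" by (auto simp: bij_betw_def)
  have "poset_graph A \<beta> E"
  proof
    show "\<exists>a\<in>A. \<exists>b\<in>A. e = {a, \<beta> b}" if "e \<in> E" for e using edges[OF that] img by blast
    show "A \<inter> \<beta> ` A = {}" using img disj by simp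
    show "{a, \<beta> a} \<in> E" if "a \<in> A" for a using m that by (simp add: matched_def)
    show "a = b" if "a \<in> A" "b \<in> A" "{a, \<beta> b} \<in> E" "{b, \<beta> a} \<in> E" for a b
      using m that unfolding matched_def by simp
  qed (fact finite_A inj matched_trans[OF m])+
  then show thesis using img by (rule that)
qed

end

text \<open>An edge inside the symmetric difference meets both covers, so it has one end on each
  side. Minimality of \<open>C1\<close> gives each \<open>a \<in> C1 - C2\<close> an edge that
  \<open>C1\<close> meets in \<open>a\<close> alone; its other end must lie in \<open>C2\<close>, so
  this edge survives in \<open>G[L]\<close>.\<close>

lemma symdiff_swap_graph:
  fixes V :: "'v set" and C1 C2 :: "'v set"
  assumes G: "simple_graph V E"
    and C: "min_vertex_cover V E C1" "min_vertex_cover V E C2"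
    and L: "unmixed ((C1 - C2) \<union> (C2 - C1)) (induced_edges E ((C1 - C2) \<union> (C2 - C1)))"
  shows "swap_graph (C1 - C2) (C2 - C1) (induced_edges E ((C1 - C2) \<union> (C2 - C1)))"
proof
  let ?A = "C1 - C2" and ?B = "C2 - C1"
  let ?E = "induced_edges E (?A \<union> ?B)"
  have sub: "C1 \<subseteq> V" "C2 \<subseteq> V" and cov: "\<And>e. e \<in> E \<Longrightarrow> e \<inter> C1 \<noteq> {}" "\<And>e. e \<in> E \<Longrightarrow> e \<inter> C2 \<noteq> {}"
    using C by (auto simp: min_vertex_cover_def vertex_cover_def)
  have fin: "finite C1" "finite C2" using sub G by (auto simp: simple_graph_def intro: finite_subset)
  have pair: "e = {x, y}" if "e \<in> E" "x \<in> e" "y \<in> e" "x \<noteq> y" for e x y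
  proof -
    have "card e = 2" using G that(1) by (simp add: simple_graph_def)
    then obtain p q where "e = {p, q}" by (auto simp: card_2_iff)
    then show ?thesis using that(2-4) by auto
  qed
  show "finite ?A" "finite ?B" "?A \<inter> ?B = {}" using fin by auto
  show "\<exists>a\<in>?A. \<exists>b\<in>?B. e = {a, b}" if "e \<in> ?E" for e
  proof -
    have e: "e \<in> E" "e \<subseteq> ?A \<union> ?B" using that by (auto simp: induced_edges_def)
    obtain a b where "a \<in> e" "a \<in> C1" "b \<in> e" "b \<in> C2" using cov[OF e(1)] by blast
    then have "a \<in> ?A" "b \<in> ?B" "e = {a, b}" using e pair[OF e(1), of a b] by auto
    then show ?thesis by blast
  qed
  show "min_vertex_cover (?A \<union> ?B) ?E ?A"
    unfolding min_vertex_cover_def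
  proof (intro conjI allI impI)
    show "vertex_cover (?A \<union> ?B) ?E ?A"
      unfolding vertex_cover_def
    proof (intro conjI ballI)
      fix e assume "e \<in> ?E"
      then show "e \<inter> ?A \<noteq> {}" using cov(1)[of e] by (auto simp: induced_edges_def)
    qed auto
    fix D assume "D \<subset> ?A"
    then obtain a where a: "a \<in> ?A" "D \<subseteq> ?A - {a}" by blast
    have "C1 - {a} \<subset> C1" using a by blast
    then have "\<not> vertex_cover V E (C1 - {a})" using C(1) unfolding min_vertex_cover_def by blast
    then obtain e where e: "e \<in> E" "e \<inter> (C1 - {a}) = {}" using sub(1) unfolding vertex_cover_def by blast
    then have ae: "a \<in> e" using cov(1) by blast
    obtain x where x: "x \<in> e" "x \<in> C2" using cov(2)[OF e(1)] by blast
    then have "x \<notin> C1" "x \<noteq> a" using e(2) a by auto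
    then have "e = {a, x}" using pair[OF e(1) ae x(1)] by auto
    then have "e \<in> ?E" using e(1) a x \<open>x \<notin> C1\<close> by (auto simp: induced_edges_def)
    moreover have "e \<inter> D = {}" using e(2) a by blast
    ultimately show "\<not> vertex_cover (?A \<union> ?B) ?E D" unfolding vertex_cover_def by blast
  qed
  show "unmixed (?A \<union> ?B) ?E" by (rule L)
qed

theorem theorem5p15:
  fixes V :: "'v set" and E :: "'v set set" and C1 C2 :: "'v set"
  assumes "simple_graph V E"
    and "unmixed V E"
    and "linearly_presented V (cover_gens V E :: ('v, 'k::field) mpoly set)"
    and "min_vertex_cover V E C1" and "min_vertex_cover V E C2" and "C1 \<noteq> C2"
    and "unmixed ((C1 - C2) \<union> (C2 - C1)) (induced_edges E ((C1 - C2) \<union> (C2 - C1)))"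
    and "\<not> cm_graph TYPE('k) ((C1 - C2) \<union> (C2 - C1)) (induced_edges E ((C1 - C2) \<union> (C2 - C1)))"
  shows "\<exists>C. min_vertex_cover V E C \<and> \<not> (C1 \<inter> C2 \<subseteq> C) \<and> C \<subseteq> C1 \<union> C2"
proof (rule ccontr)
  assume "\<not> ?thesis"
  then have contains: "C1 \<inter> C2 \<subseteq> C" if "min_vertex_cover V E C" "C \<subseteq> C1 \<union> C2" for C
    using that by blast
  let ?A = "C1 - C2" and ?B = "C2 - C1"
  let ?L = "?A \<union> ?B"
  let ?E = "induced_edges E ?L"
  interpret swap_graph ?A ?B ?E
    by (rule symdiff_swap_graph[OF assms(1,4,5,7)])
  have finV: "finite V" using assms(1) by (simp add: simple_graph_def)
  have fin: "finite C" if "min_vertex_cover V E C" for C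
    using that finV by (auto simp: min_vertex_cover_def vertex_cover_def intro: finite_subset)
  \<comment> \<open>By \<open>contains\<close>, such a cover loses exactly
    \<open>C1 \<inter> C2\<close> on passing to \<open>?L\<close>; unmixedness of \<open>G\<close>
    then fixes the size of the trace.\<close>
  have card_L: "card (C \<inter> ?L) = card ?A" if C: "min_vertex_cover V E C" "C \<subseteq> C1 \<union> C2" for C
  proof -
    have "C \<inter> ?L = C - (C1 \<inter> C2)" using C(2) by blast
    then have "card (C \<inter> ?L) = card C - card (C1 \<inter> C2)"
      using contains[OF C] fin[OF assms(4)] by (simp add: card_Diff_subset)
    moreover have "card C = card C1" using assms(2,4) C(1) unfolding unmixed_def by blast
    ultimately show ?thesis using fin[OF assms(4)] by (simp add: card_Diff_subset_Int)
  qed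
  have step: "(D \<inter> ?L, D' \<inter> ?L) \<in> near" if "(D, D') \<in> swap_rel V E (C1 \<union> C2)" for D D'
  proof -
    from that obtain v w where D': "min_vertex_cover V E D'" "D' \<subseteq> C1 \<union> C2" "D' = insert w (D - {v})"
      by (auto simp: swap_rel_def)
    have "vertex_cover ?L ?E (D' \<inter> ?L)"
      unfolding vertex_cover_def
    proof (intro conjI ballI)
      fix e assume e: "e \<in> ?E"
      then have "e \<inter> D' \<noteq> {}"
        using vertex_coverD(2)[of V E D' e] D'(1) by (simp add: min_vertex_cover_def induced_edges_def)
      then show "e \<inter> (D' \<inter> ?L) \<noteq> {}" using e by (auto simp: induced_edges_def)
    qed auto
    moreover have "D \<inter> ?L - {v} \<subseteq> D' \<inter> ?L" "D' \<inter> ?L \<subseteq> insert w (D \<inter> ?L)" using D'(3) by auto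
    ultimately show ?thesis
      using card_L[OF D'(1,2)] unfolding near_def by blast
  qed
  have "(C1 \<inter> ?L, D \<inter> ?L) \<in> near\<^sup>*" if "(C1, D) \<in> (swap_rel V E (C1 \<union> C2))\<^sup>*" for D
    using that by (induction rule: rtrancl_induct) (auto intro: rtrancl_into_rtrancl step)
  then have "(C1 \<inter> ?L, C2 \<inter> ?L) \<in> near\<^sup>*"
    using linearly_presented_swap_path[OF finV assms(3-5)] .
  moreover have "C1 \<inter> ?L = ?A" "C2 \<inter> ?L = ?B" by auto
  ultimately have "(?A, ?B) \<in> near\<^sup>*" by simp
  then obtain \<beta> where \<beta>: "poset_graph ?A \<beta> ?E" "\<beta> ` ?A = ?B"
    by (rule swap_path_poset_graph)
  have "cohen_macaulay ?L (edge_ideal ?L ?E :: ('v, 'k) mpoly set)"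
    using poset_graph.cohen_macaulay_edge_ideal[OF \<beta>(1), where 'k = 'k]
    unfolding poset_graph.V_def[OF \<beta>(1)] \<beta>(2) .
  then show False using assms(8) by (simp add: cm_graph_def)
qed

end
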